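(* Let $m,n\ge 1$ and let $\mathcal F$ be a family of holomorphic mappings of a domain $D\subset\mathbb C^m$ into $P^n(\mathbb C)$. For each $f\in\mathcal F$, let $H_{1f},\dots,H_{(2n+1)f}$ be $2n+1$ holomorphic mappings of $D$ into $P^n(\mathbb C)$ such that the following condition holds: for each compact subset $K$ of $D$ there is a constant $\delta_K>0$ such that $$d_{FS}\big(H_{j_0f}(z),\dots,H_{j_nf}(z)\big)\ge\delta_K$$ for all subsets $\{j_0,\dots,j_n\}\subset\{1,\dots,2n+1\}$ (of $n+1$ distinct indices), all $z\in K$ and all $f\in\mathcal F$. Assume that $f^{-1}(H_{jf})=\varnothing$ for all $f\in\mathcal F$ and all $j\in\{1,\dots,2n+1\}$. Then $\mathcal F$ is normal on $D$.
   Context: $P^n(\mathbb C)$ is complex projective $n$-space. For $n+1$ points $a_0,\dots,a_n\in P^n(\mathbb C)$, $d_{FS}(a_0,\dots,a_n)$ denotes the minimum over $i\in\{0,\dots,n\}$ of the Fubini-Study distance from $a_i$ to the projective subspace generated by the other $n$ points $a_k$, $k\ne i$. A reduced representation of a holomorphic mapping $f$ into $P^n(\mathbb C)$ on an open set $U$ is an $(n+1)$-tuple $(f_0,\dots,f_n)$ of holomorphic functions on $U$ without common zeros such that $f=(f_0:\cdots:f_n)$ on $U$. Let $f,H$ be holomorphic mappings of $D$ into $P^n(\mathbb C)$. In a neighbourhood $U$ of each point of $D$ take reduced representations $\widehat f=(f_0,\dots,f_n)$ of $f$ and $\widehat H=(a_0,\dots,a_n)$ of $H$, and put $\langle\widehat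 f,\widehat H\rangle:=a_0f_0+\cdots+a_nf_n$. The zero divisor of this function does not depend on the choice of reduced representations, so it is well defined on all of $D$. The set $f^{-1}(H)$ is the set of points of $D$ where this divisor is positive, i.e. where $\langle\widehat f,\widehat H\rangle$ vanishes; thus $f^{-1}(H)=\varnothing$ means that $\langle \widehat f,\widehat H\rangle$ has no zeros. A family $\mathcal F$ of holomorphic mappings of $D$ into $P^n(\mathbb C)$ is normal on $D$ if every sequence in $\mathcal F$ has a subsequence converging uniformly on compact subsets of $D$ (with respect to the Fubini-Study metric) to a holomorphic mapping of $D$ into $P^n(\mathbb C)$. *)

theory Defs
  imports "HOL-Analysis.Analysis"
begin

section \<open>Complex projective space with the Fubini--Study metric\<close>

definition cinner :: "complex ^ 'k \<Rightarrow> complex ^ 'k \<Rightarrow> complex" where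
  "cinner v w = (\<Sum>i\<in>UNIV. v $ i * cnj (w $ i))"

lemma norm_cvec: "norm (v :: complex ^ 'k) = L2_set (\<lambda>i. cmod (v $ i)) UNIV"
  by (simp add: norm_vec_def)

lemma mult_cnj_cmod: "z * cnj z = (complex_of_real (cmod z))\<^sup>2"
  by (metis complex_norm_square of_real_power)

lemma cinner_self: "cinner v v = of_real ((norm v)\<^sup>2)"
  unfolding cinner_def norm_cvec L2_set_def
  by (simp add: sum_nonneg mult_cnj_cmod)

lemma cinner_commute: "cinner w v = cnj (cinner v w)"
  by (simp add: cinner_def mult.commute)

lemma cinner_diff_left: "cinner (u - v) w = cinner u w - cinner v w"
  by (simp add: cinner_def algebra_simps sum_subtractf)

lemma cinner_diff_right: "cinner u (v - w) = cinner u v - cinner u w"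
  by (simp add: cinner_def algebra_simps sum_subtractf)

lemma cinner_scale_left: "cinner (c *s v) w = c * cinner v w"
  by (simp add: cinner_def sum_distrib_left mult_ac)

lemma cinner_scale_right: "cinner v (c *s w) = cnj c * cinner v w"
  by (simp add: cinner_def sum_distrib_left mult_ac)

lemmas cinner_simps = cinner_diff_left cinner_diff_right cinner_scale_left cinner_scale_right

lemma norm_cscale: "norm (c *s (v :: complex ^ 'k)) = cmod c * norm v"
  unfolding norm_cvec by (simp add: norm_mult L2_set_right_distrib)

lemma cinner_Cauchy_Schwarz: "cmod (cinner v w) \<le> norm v * norm w"
proof -
  have "cmod (cinner v w) \<le> (\<Sum>i\<in>UNIV. cmod (v $ i) * cmod (w $ i))"
    unfolding cinner_def by (rule order_trans[OF norm_sum]) (simp add: norm_mult)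
  also have "\<dots> \<le> norm v * norm w"
    unfolding norm_cvec using L2_set_mult_ineq[of "\<lambda>i. cmod (v $ i)" "\<lambda>i. cmod (w $ i)" UNIV]
    by simp
  finally show ?thesis .
qed

definition fs_cos :: "complex ^ 'k \<Rightarrow> complex ^ 'k \<Rightarrow> real" where
  "fs_cos v w = cmod (cinner v w) / (norm v * norm w)"

lemma fs_cos_bounds: "0 \<le> fs_cos v w" "fs_cos v w \<le> 1"
  using cinner_Cauchy_Schwarz[of v w]
  by (auto simp: fs_cos_def divide_le_eq_1 less_le)

lemma fs_cos_commute: "fs_cos v w = fs_cos w v"
  unfolding fs_cos_def by (subst cinner_commute) (simp add: mult.commute)

lemma fs_cos_scale:
  assumes "c \<noteq> 0" shows "fs_cos (c *s v) w = fs_cos v w"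
  using assms by (simp add: fs_cos_def cinner_simps norm_cscale norm_mult)

lemma norm_perp:
  assumes "norm u = 1" "norm v = 1"
  shows "norm (u - cinner u v *s v) = sqrt (1 - (cmod (cinner u v))\<^sup>2)"
proof -
  have vv: "cinner v v = 1" "cinner u u = 1" using assms by (simp_all add: cinner_self)
  have "of_real ((norm (u - cinner u v *s v))\<^sup>2)
      = cinner (u - cinner u v *s v) (u - cinner u v *s v)"
    by (simp only: cinner_self)
  also have "\<dots> = 1 - cinner u v * cnj (cinner u v)"
    using cinner_commute[of v u] vv by (simp add: cinner_simps algebra_simps)
  also have "\<dots> = of_real (1 - (cmod (cinner u v))\<^sup>2)"
    by (simp add: mult_cnj_cmod)
  finally have "(norm (u - cinner u v *s v))\<^sup>2 = 1 - (cmod (cinner u v))\<^sup>2"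
    unfolding of_real_eq_iff .
  then show ?thesis by (metis norm_ge_zero real_sqrt_abs abs_of_nonneg)
qed

lemma fs_triangle_unit:
  assumes "norm u = 1" "norm v = 1" "norm w = 1"
  shows "arccos (cmod (cinner u w)) \<le> arccos (cmod (cinner u v)) + arccos (cmod (cinner v w))"
proof -
  define a b c where "a = cmod (cinner u v)" and "b = cmod (cinner v w)" and "c = cmod (cinner u w)"
  have r: "0 \<le> a" "a \<le> 1" "0 \<le> b" "b \<le> 1" "0 \<le> c" "c \<le> 1"
    using cinner_Cauchy_Schwarz[of u v] cinner_Cauchy_Schwarz[of v w] cinner_Cauchy_Schwarz[of u w] assms
    by (auto simp: a_def b_def c_def)
  have vv: "cinner v v = 1" using assms by (simp add: cinner_self)
  have wv: "cmod (cinner w v) = b"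
    by (subst cinner_commute) (simp add: b_def)
  let ?p = "u - cinner u v *s v" and ?q = "w - cinner w v *s v"
  have "cinner ?p ?q = cinner u w - cinner u v * cinner v w"
    using vv cinner_commute[of w v] by (simp add: cinner_simps algebra_simps)
  then have "cinner u v * cinner v w = cinner u w - cinner ?p ?q" by simp
  then have "a * b = cmod (cinner u w - cinner ?p ?q)"
    unfolding a_def b_def by (metis norm_mult)
  also have "\<dots> \<le> c + cmod (cinner ?p ?q)"
    unfolding c_def by (rule norm_triangle_ineq4)
  also have "\<dots> \<le> c + norm ?p * norm ?q"
    using cinner_Cauchy_Schwarz by simp
  also have "\<dots> = c + sqrt (1 - a\<^sup>2) * sqrt (1 - b\<^sup>2)"
    using norm_perp[of u v] norm_perp[of w v] assms wv by (simp add: a_def)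
  finally have *: "a * b - sqrt (1 - a\<^sup>2) * sqrt (1 - b\<^sup>2) \<le> c" by simp
  have h: "arccos a \<le> pi / 2" "arccos b \<le> pi / 2" "0 \<le> arccos a" "0 \<le> arccos b"
    using r arccos_le_pi2[of a] arccos_le_pi2[of b] by (auto intro: arccos_lbound)
  have "cos (arccos a + arccos b) \<le> c"
    using * r by (simp add: cos_add sin_arccos)
  then have "arccos c \<le> arccos (cos (arccos a + arccos b))"
    using r by (intro arccos_le_arccos) (auto intro: cos_ge_minus_one)
  also have "\<dots> = arccos a + arccos b"
    using h by (intro arccos_cos) auto
  finally show ?thesis by (simp add: a_def b_def c_def)
qed

lemma fs_triangle:
  assumes "u \<noteq> 0" "v \<noteq> 0" "w \<noteq> 0"
  shows "arccos (fs_cos u w) \<le> arccos (fs_cos u v) + arccos (fs_cos v w)"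
proof -
  define N :: "complex ^ 'a \<Rightarrow> complex ^ 'a" where "N x = of_real (1 / norm x) *s x" for x
  have n: "norm (N x) = 1" if "x \<noteq> 0" for x
    using that by (simp add: N_def norm_cscale norm_divide)
  have i: "cmod (cinner (N x) (N y)) = fs_cos x y" for x y
    by (simp add: N_def cinner_simps fs_cos_def norm_mult norm_divide)
  show ?thesis
    using fs_triangle_unit[of "N u" "N v" "N w"] n assms by (simp add: i)
qed

lemma fs_cos_eq_1:
  assumes "v \<noteq> 0" "w \<noteq> 0"
  shows "fs_cos v w = 1 \<longleftrightarrow> (\<exists>c. c \<noteq> 0 \<and> w = c *s v)"
proof
  assume "\<exists>c. c \<noteq> 0 \<and> w = c *s v"
  then obtain c where "c \<noteq> 0" "w = c *s v" by blast
  then show "fs_cos v w = 1"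
    using assms by (simp add: fs_cos_def cinner_simps cinner_self norm_cscale norm_mult power2_eq_square)
next
  assume 1: "fs_cos v w = 1"
  define d where "d = cinner w v / of_real ((norm v)\<^sup>2)"
  have nz: "norm v \<noteq> 0" "norm w \<noteq> 0" using assms by auto
  have eq: "cmod (cinner w v) = norm v * norm w"
    using 1 nz by (subst cinner_commute) (simp add: fs_cos_def field_simps)
  have vw: "cinner v w = cnj (cinner w v)" by (rule cinner_commute)
  have "cinner w v * cnj (cinner w v) = of_real ((norm v)\<^sup>2 * (norm w)\<^sup>2)"
    using eq by (simp add: mult_cnj_cmod power_mult_distrib)
  moreover have "cinner (w - d *s v) (w - d *s v)
      = cinner w w - cnj d * cinner w v - d * cnj (cinner w v) + d * cnj d * cinner v v"
    using vw by (simp add: cinner_simps algebra_simps)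
  ultimately have "cinner (w - d *s v) (w - d *s v) = 0"
    using nz by (simp add: cinner_self[of v] cinner_self[of w] d_def field_simps power2_eq_square)
  then have "w = d *s v" by (simp add: cinner_self)
  moreover have "d \<noteq> 0" using calculation assms by auto
  ultimately show "\<exists>c. c \<noteq> 0 \<and> w = c *s v" by blast
qed

text \<open>\<open>'k cproj\<close> is the projective space of dimension \<open>CARD('k) - 1\<close>, with homogeneous
  coordinates indexed by \<open>'k\<close>. The function \<open>abs_cproj\<close> sends a nonzero vector
  to the point with these homogeneous coordinates; it is meaningless at the zero vector.\<close>

quotient_type 'k cproj = "complex ^ 'k::finite" /
  partial: "\<lambda>v w. v \<noteq> 0 \<and> w \<noteq> 0 \<and> (\<exists>c. c \<noteq> 0 \<and> w = c *s v)"
proof (rule part_equivpI)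
  have "axis undefined 1 \<noteq> (0 :: complex ^ 'k)" by (simp add: axis_eq_0_iff)
  then show "\<exists>v::complex ^ 'k. v \<noteq> 0 \<and> v \<noteq> 0 \<and> (\<exists>c. c \<noteq> 0 \<and> v = c *s v)"
    by (metis vector_smult_lid zero_neq_one)
  show "symp (\<lambda>v w :: complex ^ 'k. v \<noteq> 0 \<and> w \<noteq> 0 \<and> (\<exists>c. c \<noteq> 0 \<and> w = c *s v))"
  proof (rule sympI, elim conjE exE, intro conjI)
    fix v w :: "complex ^ 'k" and c assume "c \<noteq> 0" "w = c *s v"
    then show "\<exists>c. c \<noteq> 0 \<and> v = c *s w"
      by (intro exI[of _ "inverse c"]) simp
  qed
  show "transp (\<lambda>v w :: complex ^ 'k. v \<noteq> 0 \<and> w \<noteq> 0 \<and> (\<exists>c. c \<noteq> 0 \<and> w = c *s v))"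
  proof (rule transpI, elim conjE exE, intro conjI)
    fix u v w :: "complex ^ 'k" and c d assume "c \<noteq> 0" "d \<noteq> 0" "v = c *s u" "w = d *s v"
    then show "\<exists>c. c \<noteq> 0 \<and> w = c *s u"
      by (intro exI[of _ "d * c"]) simp
  qed
qed

instantiation cproj :: (finite) metric_space
begin

text \<open>The Fubini--Study distance is normalised so that the diameter of the space is \<open>pi / 2\<close>.\<close>

lift_definition dist_cproj :: "'a cproj \<Rightarrow> 'a cproj \<Rightarrow> real"
  is "\<lambda>v w. arccos (fs_cos v w)"
  by (metis fs_cos_scale fs_cos_commute)

definition uniformity_cproj :: "('a cproj \<times> 'a cproj) filter" where
  "uniformity_cproj = (INF e\<in>{0<..}. principal {(x, y). dist x y < e})"

definition open_cproj :: "'a cproj set \<Rightarrow> bool" where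
  "open_cproj U \<longleftrightarrow> (\<forall>x\<in>U. \<forall>\<^sub>F (x', y) in uniformity. x' = x \<longrightarrow> y \<in> U)"

instance
proof
  fix x y z :: "'a cproj"
  show "dist x y = 0 \<longleftrightarrow> x = y"
  proof transfer
    fix v w :: "complex ^ 'a"
    assume v: "v \<noteq> 0 \<and> v \<noteq> 0 \<and> (\<exists>c. c \<noteq> 0 \<and> v = c *s v)"
      and w: "w \<noteq> 0 \<and> w \<noteq> 0 \<and> (\<exists>c. c \<noteq> 0 \<and> w = c *s w)"
    have "arccos (fs_cos v w) = 0 \<longleftrightarrow> fs_cos v w = 1"
      using fs_cos_bounds[of v w] by (metis arccos_1 cos_arccos cos_zero dual_order.trans neg_le_0_iff_le zero_le_one)
    then show "(arccos (fs_cos v w) = 0) = (v \<noteq> 0 \<and> w \<noteq> 0 \<and> (\<exists>c. c \<noteq> 0 \<and> w = c *s v))"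
      using fs_cos_eq_1 v w by blast
  qed
  show "dist x y \<le> dist x z + dist y z"
    by transfer (metis fs_triangle fs_cos_commute)
qed (simp_all add: uniformity_cproj_def open_cproj_def)

end

lemma abs_cproj_eq_iff:
  assumes "v \<noteq> 0" "w \<noteq> 0"
  shows "abs_cproj v = abs_cproj w \<longleftrightarrow> (\<exists>c. c \<noteq> 0 \<and> w = c *s v)"
proof -
  have "v = 1 *s v" "w = 1 *s w" by simp_all
  then show ?thesis
    using assms Quotient_rel[OF Quotient_cproj, of v w] zero_neq_one by metis
qed

lemma dist_abs_cproj:
  assumes "v \<noteq> 0" "w \<noteq> 0"
  shows "dist (abs_cproj v) (abs_cproj w) = arccos (cmod (cinner v w) / (norm v * norm w))"
proof -
  have "v = 1 *s v" "w = 1 *s w" by simp_all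
  then show ?thesis
    using assms dist_cproj.abs_eq[of v w] zero_neq_one by (metis fs_cos_def)
qed

definition proj_span :: "'k cproj set \<Rightarrow> 'k::finite cproj set" where
  "proj_span A = abs_cproj ` (vec.span {v. v \<noteq> 0 \<and> abs_cproj v \<in> A} - {0})"

text \<open>The points are given as a family indexed by a finite set \<open>J\<close>, so that repeated points
  are allowed; the distance is then 0.\<close>

definition d_FS :: "'i set \<Rightarrow> ('i \<Rightarrow> 'k::finite cproj) \<Rightarrow> real" where
  "d_FS J a = Min ((\<lambda>i. infdist (a i) (proj_span (a ` (J - {i})))) ` J)"


section \<open>Holomorphic mappings and normal families\<close>

definition holomorphic_fun :: "(complex ^ 'm) set \<Rightarrow> (complex ^ 'm \<Rightarrow> complex) \<Rightarrow> bool" where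
  "holomorphic_fun U g \<longleftrightarrow>
     (\<forall>z\<in>U. \<exists>g'. (g has_derivative g') (at z) \<and> (\<forall>c v. g' (c *s v) = c * g' v))"

definition reduced_rep ::
  "(complex ^ 'm) set \<Rightarrow> (complex ^ 'm \<Rightarrow> complex ^ 'k) \<Rightarrow> (complex ^ 'm \<Rightarrow> 'k::finite cproj) \<Rightarrow> bool"
where
  "reduced_rep U g f \<longleftrightarrow>
     (\<forall>i. holomorphic_fun U (\<lambda>z. g z $ i)) \<and> (\<forall>z\<in>U. g z \<noteq> 0 \<and> f z = abs_cproj (g z))"

definition holomorphic_map ::
  "(complex ^ 'm) set \<Rightarrow> (complex ^ 'm \<Rightarrow> 'k::finite cproj) \<Rightarrow> bool"
where
  "holomorphic_map D f \<longleftrightarrow>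
     (\<forall>z\<in>D. \<exists>U g. open U \<and> z \<in> U \<and> U \<subseteq> D \<and> reduced_rep U g f)"

definition pairing :: "complex ^ 'k \<Rightarrow> complex ^ 'k \<Rightarrow> complex" where
  "pairing v a = (\<Sum>i\<in>UNIV. a $ i * v $ i)"

text \<open>The set \<open>f\<^sup>-\<^sup>1(H)\<close>: whether the pairing vanishes at \<open>z\<close> does not depend on the
  reduced representations chosen.\<close>

definition inverse_image ::
  "(complex ^ 'm) set \<Rightarrow> (complex ^ 'm \<Rightarrow> 'k::finite cproj) \<Rightarrow> (complex ^ 'm \<Rightarrow> 'k cproj) \<Rightarrow>
   (complex ^ 'm) set"
where
  "inverse_image D f H =
     {z \<in> D. \<exists>U g h. open U \<and> z \<in> U \<and> U \<subseteq> D \<and> reduced_rep U g f \<and> reduced_rep U h H \<and>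
        pairing (g z) (h z) = 0}"

definition normal_family ::
  "(complex ^ 'm) set \<Rightarrow> (complex ^ 'm \<Rightarrow> 'k::finite cproj) set \<Rightarrow> bool"
where
  "normal_family D \<F> \<longleftrightarrow>
     (\<forall>s :: nat \<Rightarrow> complex ^ 'm \<Rightarrow> 'k cproj. range s \<subseteq> \<F> \<longrightarrow>
        (\<exists>r g. strict_mono r \<and> holomorphic_map D g \<and>
           (\<forall>K. compact K \<and> K \<subseteq> D \<longrightarrow> uniform_limit K (\<lambda>k. s (r k)) g sequentially)))"

end

theory Submission
  imports Defs "HOL-Complex_Analysis.Great_Picard"
begin

text \<open>Normality is local and amounts to finding, on a ball of uniform radius, a reduced
  representation of each \<open>f\<close> whose norm is bounded above and away from zero by uniform constants.

  For the hyperplanes: if \<open>a\<close> represents a frame of \<open>n + 1\<close> of them and \<open>b\<close> is the dual vector of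
  \<open>a k\<close>, the rank one projection with entries \<open>b $ l * a k $ j\<close> does not change when the
  representatives are rescaled. It is therefore globally defined and holomorphic, uniformly bounded
  by general position, and has trace 1; one of its columns represents the \<open>k\<close>-th hyperplane.

  For \<open>f\<close>: the values \<open>F j\<close> of the hyperplanes on \<open>f\<close> have no zeros, and at every point at least
  \<open>n + 1\<close> of the \<open>2 * n + 1\<close> moduli are comparable with the largest one. Two such majorities always
  intersect, which forces a single index to dominate near a given point, with a uniform constant.
  Otherwise one selects a disc on which domination fails by the factor \<open>exp \<Lambda>\<close> while it holds on
  all discs of half the radius nearby, divides the logarithms by \<open>\<Lambda>\<close> and passes to the limit: by
  unique continuation one limit function realises the maximal modulus everywhere, and it violates
  the minimum modulus principle. Dividing by the dominating \<open>F s\<close> gives the representation.\<close>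

section \<open>Majorities among holomorphic functions of one variable\<close>

text \<open>The number 2n+1 enters through a count: if n+1 of the values \<open>F j\<close> were too
  small compared with the largest one, the frame of these hyperplanes would make the representing
  vector smaller than itself. So at most n are small, and the remaining n+1 or more form a majority.
  After restriction to complex lines only zero-free functions on a disc remain. The hyperplanes are
  never passed to a limit: only bounds for their representations enter, so it does not matter how
  they vary with f.

  The obstacle to the blow-down is circular: after division by \<open>\<Lambda>\<close> the
  differences of the logarithms need a bound known before \<open>\<Lambda>\<close> is chosen. The
  selection of the disc breaks the circle. If all nearby discs of half the radius are good,
  Harnack's inequality carries domination along a chain of eight steps, each costing at most a
  factor 8. The resulting bound \<open>8 ^ 8 * \<Lambda>\<close> has a purely numerical factor, so
  the limit is studied with this factor fixed and \<open>\<Lambda>\<close> is chosen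
  afterwards.\<close>

text \<open>On a disc in \<open>U\<close> where \<open>g\<close> has no zeros, \<open>f / g\<close>
  has constant modulus 1 and is therefore a constant \<open>c\<close>. The identity
  \<open>f = c * g\<close> continues to all of \<open>S\<close>, across the zeros of
  \<open>g\<close> as well. If \<open>g\<close> vanishes on \<open>U\<close>, so does
  \<open>f\<close>.\<close>

lemma norm_eq_continuation:
  fixes f g :: "complex \<Rightarrow> complex"
  assumes S: "open S" "connected S" and hol: "f holomorphic_on S" "g holomorphic_on S"
    and U: "open U" "U \<noteq> {}" "U \<subseteq> S" and eq: "\<And>z. z \<in> U \<Longrightarrow> norm (f z) = norm (g z)"
    and "w \<in> S"
  shows "norm (f w) = norm (g w)"
proof (cases "\<forall>z\<in>U. g z = 0")
  case True
  with eq have "\<And>z. z \<in> U \<Longrightarrow> f z = g z" by (metis norm_eq_zero)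
  then show ?thesis
    using analytic_continuation_open[OF U(1) S(1) U(2) S(2) U(3) hol] \<open>w \<in> S\<close> by metis
next
  case False
  then obtain a where a: "a \<in> U" "g a \<noteq> 0" by blast
  have "continuous_on U g"
    using hol(2) U(3) holomorphic_on_imp_continuous_on holomorphic_on_subset by blast
  then have "open (U \<inter> g -` (- {0}))"
    using U(1) by (intro continuous_open_preimage) auto
  then obtain e where e: "e > 0" "ball a e \<subseteq> U \<inter> g -` (- {0})"
    using a by (metis Compl_iff Int_iff openE singletonD vimage_eq)
  define q where "q = (\<lambda>z. f z / g z)"
  have hq: "q holomorphic_on ball a e"
    unfolding q_def using e U(3) hol
    by (intro holomorphic_intros) (auto intro: holomorphic_on_subset)
  have q1: "norm (q z) = 1" if "z \<in> ball a e" for z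
    using that e eq[of z] by (auto simp: q_def norm_divide subset_eq)
  have "q constant_on ball a e"
    by (rule maximum_modulus_principle[OF hq, where U = "ball a e" and \<xi> = a])
       (use e q1 in auto)
  then obtain c where c: "\<And>z. z \<in> ball a e \<Longrightarrow> q z = c" by (auto simp: constant_on_def)
  have "a \<in> ball a e" using e by simp
  then have c1: "norm c = 1" using q1 c by metis
  have "f w = c * g w"
  proof (rule analytic_continuation_open[OF _ S(1) _ S(2), of "ball a e" f "\<lambda>z. c * g z"])
    fix z assume z: "z \<in> ball a e"
    then have "g z \<noteq> 0" using e by auto
    with c[OF z] show "f z = c * g z" by (simp add: q_def field_simps)
  qed (use e U hol \<open>w \<in> S\<close> in \<open>auto intro!: holomorphic_intros\<close>)
  then show ?thesis using c1 by (simp add: norm_mult)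
qed

lemma majorities_meet:
  assumes "finite I" "A \<subseteq> I" "B \<subseteq> I" "card I < 2 * card A" "card I < 2 * card B"
  obtains i where "i \<in> A" "i \<in> B"
proof -
  have "A \<inter> B \<noteq> {}"
  proof
    assume "A \<inter> B = {}"
    then have "card (A \<union> B) = card A + card B"
      using assms by (intro card_Un_disjoint) (auto intro: finite_subset)
    moreover have "card (A \<union> B) \<le> card I" using assms by (intro card_mono) auto
    ultimately show False using assms by linarith
  qed
  then show ?thesis using that by blast
qed

text \<open>At a point where the number of coincidences among the moduli is minimal, the
  coincidences persist nearby, hence everywhere.\<close>

lemma majority_dominant:
  fixes E :: "'i \<Rightarrow> complex \<Rightarrow> complex"
  assumes "finite I" and S: "open S" "connected S" "S \<noteq> {}"
    and hol: "\<And>j. j \<in> I \<Longrightarrow> E j holomorphic_on S"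
    and maj: "\<And>z. z \<in> S \<Longrightarrow> card I < 2 * card {i \<in> I. \<forall>j\<in>I. norm (E j z) \<le> norm (E i z)}"
  obtains s where "s \<in> I" "\<And>z j. z \<in> S \<Longrightarrow> j \<in> I \<Longrightarrow> norm (E j z) \<le> norm (E s z)"
proof -
  define eqs where "eqs z = {(i, j). i \<in> I \<and> j \<in> I \<and> norm (E i z) = norm (E j z)}" for z
  define T where "T z = {i \<in> I. \<forall>j\<in>I. norm (E j z) \<le> norm (E i z)}" for z
  have fin: "finite (eqs z)" for z
    by (rule finite_subset[of _ "I \<times> I"]) (use assms(1) in \<open>auto simp: eqs_def\<close>)
  obtain x where x: "x \<in> S" and xmin: "\<And>y. y \<in> S \<Longrightarrow> card (eqs x) \<le> card (eqs y)"
    using ex_has_least_nat[of "\<lambda>x. x \<in> S" _ "\<lambda>x. card (eqs x)"] S(3) by blast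
  define U where "U = S \<inter> (\<Inter>p\<in>I \<times> I - eqs x. {z \<in> S. norm (E (fst p) z) \<noteq> norm (E (snd p) z)})"
  have cont: "continuous_on S (E j)" if "j \<in> I" for j
    using hol[OF that] holomorphic_on_imp_continuous_on by blast
  have op: "open {z \<in> S. norm (E i z) \<noteq> norm (E j z)}" if "i \<in> I" "j \<in> I" for i j
  proof -
    have "open (S \<inter> (\<lambda>z. norm (E i z) - norm (E j z)) -` (- {0}))"
      using S(1) cont that by (intro continuous_open_preimage continuous_intros) auto
    also have "S \<inter> (\<lambda>z. norm (E i z) - norm (E j z)) -` (- {0}) = {z \<in> S. norm (E i z) \<noteq> norm (E j z)}"
      by auto
    finally show ?thesis .
  qed
  have U: "open U" "x \<in> U" "U \<subseteq> S"
    unfolding U_def using S(1) op assms(1) x by (auto simp: eqs_def intro!: open_Int open_INT)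
  \<comment> \<open>Strict inequality of two moduli at \<open>x\<close> persists on
    \<open>U\<close>, so \<open>eqs\<close> can only shrink there, and minimality at
    \<open>x\<close> forbids that.\<close>
  have eqs_U: "eqs z = eqs x" if "z \<in> U" for z
  proof (rule card_subset_eq[OF fin])
    show sub: "eqs z \<subseteq> eqs x"
    proof (rule ccontr)
      assume "\<not> eqs z \<subseteq> eqs x"
      then obtain p where p: "p \<in> eqs z" "p \<notin> eqs x" by blast
      then have "p \<in> I \<times> I - eqs x" by (auto simp: eqs_def)
      then have "norm (E (fst p) z) \<noteq> norm (E (snd p) z)" using that unfolding U_def by blast
      with p show False by (auto simp: eqs_def)
    qed
    show "card (eqs z) = card (eqs x)"
      using xmin[of z] card_mono[OF fin sub] that U by fastforce
  qed
  have glob: "norm (E i z) = norm (E j z)" if "(i, j) \<in> eqs x" "z \<in> S" for i j z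
  proof (rule norm_eq_continuation[OF S(1,2) hol hol U(1) _ U(3) _ that(2)])
    show "norm (E i w) = norm (E j w)" if "w \<in> U" for w
      using eqs_U[OF that] \<open>(i, j) \<in> eqs x\<close> by (auto simp: eqs_def)
  qed (use that U in \<open>auto simp: eqs_def\<close>)
  have Tmaj: "card I < 2 * card (T z)" if "z \<in> S" for z
    using maj[OF that] by (simp add: T_def)
  \<comment> \<open>Taking the same majority twice merely says that it is nonempty.\<close>
  obtain s where s: "s \<in> T x"
    using majorities_meet[OF assms(1) _ _ Tmaj[OF x] Tmaj[OF x]] by (auto simp: T_def)
  show ?thesis
  proof
    show "s \<in> I" using s by (simp add: T_def)
    fix z j assume z: "z \<in> S" and j: "j \<in> I"
    \<comment> \<open>An index maximal at both points ties with \<open>s\<close> at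
      \<open>x\<close>, hence everywhere, so \<open>s\<close> inherits its maximality at
      \<open>z\<close>.\<close>
    obtain i where i: "i \<in> T x" "i \<in> T z"
      using majorities_meet[OF assms(1) _ _ Tmaj[OF x] Tmaj[OF z]] by (auto simp: T_def)
    have "(i, s) \<in> eqs x" using i s by (force simp: T_def eqs_def intro: antisym)
    then have "norm (E i z) = norm (E s z)" using glob z by blast
    then show "norm (E j z) \<le> norm (E s z)" using i j by (simp add: T_def)
  qed
qed

section \<open>Harnack's inequality and Montel's theorem for finitely many sequences\<close>

text \<open>The Moebius map sending the right half plane to the disc and \<open>p 0\<close> to 0
  turns \<open>p\<close> into the function \<open>f\<close> to which the Schwarz lemma applies. At
  half the radius \<open>f\<close> has modulus at most 1/2, and the factor is
  \<open>3 = (1 + 1/2) / (1 - 1/2)\<close>.\<close>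

lemma harnack_half:
  assumes hol: "q holomorphic_on ball z r" and pos: "\<And>w. w \<in> ball z r \<Longrightarrow> 0 \<le> Re (q w)"
    and w: "dist z w \<le> r / 2" and "r > 0"
  shows "Re (q w) \<le> 3 * Re (q z)"
proof (rule field_le_epsilon)
  fix e :: real assume e: "e > 0"
  \<comment> \<open>The shift by \<open>d\<close> makes the real part strictly positive, so that the
    denominator of \<open>f\<close> cannot vanish; it costs \<open>3 * d - d = e / 2\<close> at the
    end.\<close>
  define d where "d = e / 4"
  have d: "d > 0" using e by (simp add: d_def)
  define p where "p \<zeta> = q (z + of_real r * \<zeta>) + of_real d" for \<zeta>
  define f where "f \<zeta> = (p \<zeta> - p 0) / (p \<zeta> + cnj (p 0))" for \<zeta>
  have inb: "z + of_real r * \<zeta> \<in> ball z r" if "norm \<zeta> < 1" for \<zeta>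
    using that \<open>r > 0\<close> by (simp add: dist_norm norm_mult)
  have ppos: "Re (p \<zeta>) > 0" if "norm \<zeta> < 1" for \<zeta>
    using pos[OF inb[OF that]] d by (simp add: p_def)
  have den: "p \<zeta> + cnj (p 0) \<noteq> 0" if "norm \<zeta> < 1" for \<zeta>
  proof -
    have "Re (p \<zeta> + cnj (p 0)) > 0" using ppos[OF that] ppos[of 0] by simp
    then show ?thesis by force
  qed
  have hp: "p holomorphic_on ball 0 1"
    unfolding p_def
    by (intro holomorphic_intros holomorphic_on_compose_gen[OF _ hol, unfolded o_def])
       (use inb in auto)
  have hf: "f holomorphic_on ball 0 1"
    unfolding f_def by (intro holomorphic_intros hp) (use den in auto)
  have lt: "norm (a - b) < norm (a + cnj b)" if "Re a > 0" "Re b > 0" for a b :: complex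
  proof (rule power2_less_imp_less)
    have "(norm (a + cnj b))\<^sup>2 = (norm (a - b))\<^sup>2 + 4 * Re a * Re b"
      unfolding cmod_power2 by (simp add: power2_eq_square algebra_simps)
    moreover have "4 * Re a * Re b > 0" using that by simp
    ultimately show "(norm (a - b))\<^sup>2 < (norm (a + cnj b))\<^sup>2" by linarith
  qed simp
  have f1: "norm (f \<zeta>) < 1" if "norm \<zeta> < 1" for \<zeta>
    using lt[OF ppos[OF that] ppos[of 0]] den[OF that] by (simp add: f_def norm_divide divide_simps)
  define \<zeta> where "\<zeta> = (w - z) / of_real r"
  have \<zeta>: "norm \<zeta> \<le> 1 / 2"
    using w \<open>r > 0\<close> by (simp add: \<zeta>_def norm_divide dist_norm norm_minus_commute field_simps)
  have "norm (f \<zeta>) \<le> norm \<zeta>"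
    by (rule Schwarz_Lemma(1)[OF hf]) (use f1 \<zeta> in \<open>auto simp: f_def\<close>)
  then have f2: "norm (f \<zeta>) \<le> 1 / 2" using \<zeta> by linarith
  have \<zeta>1: "norm \<zeta> < 1" using \<zeta> by linarith
  define a b where "a = p \<zeta>" and "b = p 0"
  have "2 * norm (a - b) \<le> norm (a + cnj b)"
    using f2 den[OF \<zeta>1] by (simp add: f_def a_def b_def norm_divide divide_simps)
  \<comment> \<open>The two numbers differ by a real constant, so \<open>2 * norm (a - b)\<close> is
    at most \<open>norm (a - b) + 2 * Re b\<close>.\<close>
  also have "a + cnj b = (a - b) + of_real (2 * Re b)" by (simp add: complex_eq_iff)
  also have "norm \<dots> \<le> norm (a - b) + 2 * Re b"
    using norm_triangle_ineq[of "a - b" "of_real (2 * Re b)"] ppos[of 0]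
    by (simp add: b_def norm_of_real del: of_real_mult)
  finally have "norm (a - b) \<le> 2 * Re b" by simp
  then have "Re a \<le> 3 * Re b" using complex_Re_le_cmod[of "a - b"] by simp
  moreover have "p \<zeta> = q w + of_real d" "p 0 = q z + of_real d"
    using \<open>r > 0\<close> by (simp_all add: p_def \<zeta>_def)
  ultimately show "Re (q w) \<le> 3 * Re (q z) + e"
    using e by (simp add: a_def b_def d_def)
qed

text \<open>One subsequence has to serve all indices, because the limits are compared with each
  other pointwise. It is extracted one index at a time; the limits already found survive further
  thinning.\<close>

lemma Montel_finite:
  fixes F :: "'i \<Rightarrow> nat \<Rightarrow> complex \<Rightarrow> complex"
  assumes "finite I" "open S" and hol: "\<And>j k. j \<in> I \<Longrightarrow> F j k holomorphic_on S"
    and bd: "\<And>j k z. j \<in> I \<Longrightarrow> z \<in> S \<Longrightarrow> norm (F j k z) \<le> B"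
  shows "\<exists>r E. strict_mono (r :: nat \<Rightarrow> nat) \<and> (\<forall>j\<in>I. E j holomorphic_on S \<and>
    (\<forall>K. compact K \<longrightarrow> K \<subseteq> S \<longrightarrow> uniform_limit K (\<lambda>k. F j (r k)) (E j) sequentially))"
  using assms(1) hol bd
proof (induction I rule: finite_induct)
  case empty
  then show ?case using strict_mono_id by auto
next
  case (insert i I)
  then obtain r E where r: "strict_mono (r :: nat \<Rightarrow> nat)"
    and E: "\<And>j. j \<in> I \<Longrightarrow> E j holomorphic_on S"
      "\<And>j K. j \<in> I \<Longrightarrow> compact K \<Longrightarrow> K \<subseteq> S \<Longrightarrow> uniform_limit K (\<lambda>k. F j (r k)) (E j) sequentially"
    by (metis insert_iff)
  obtain g q where g: "g holomorphic_on S" "strict_mono (q :: nat \<Rightarrow> nat)"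
    "\<And>K. compact K \<Longrightarrow> K \<subseteq> S \<Longrightarrow> uniform_limit K ((\<lambda>k. F i (r k)) \<circ> q) g sequentially"
  proof (rule Montel[OF \<open>open S\<close>, of "range (\<lambda>k. F i (r k))" "\<lambda>k. F i (r k)"])
    show "\<exists>B. \<forall>h\<in>range (\<lambda>k. F i (r k)). \<forall>z\<in>K. norm (h z) \<le> B" if "K \<subseteq> S" for K
      using insert.prems(2)[of i] that by blast
  qed (use insert.prems in auto)
  have "uniform_limit K (\<lambda>k. F j (r (q k))) ((E(i := g)) j) sequentially"
    if "j \<in> insert i I" "compact K" "K \<subseteq> S" for j K
  proof (cases "j = i")
    case True
    then show ?thesis using g(3)[OF that(2,3)] by (simp add: o_def)
  next
    case False
    then show ?thesis
      using filterlim_compose[OF E(2)[of j K, OF _ that(2,3)] filterlim_subseq[OF g(2)]] that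
      by simp
  qed
  moreover have "(E(i := g)) j holomorphic_on S" if "j \<in> insert i I" for j
    using that E g by auto
  moreover have "strict_mono (\<lambda>k. r (q k))" using r g by (simp add: strict_mono_def)
  ultimately show ?case
    by (intro exI[of _ "\<lambda>k. r (q k)"] exI[of _ "E(i := g)"]) blast
qed

section \<open>Near-maximal indices and the blow-down limit\<close>

text \<open>The \<open>h j\<close> play the role of logarithms of zero-free functions, so the slack
  \<open>C\<close> is the logarithm of a factor between moduli.\<close>

definition near_max :: "'i set \<Rightarrow> real \<Rightarrow> ('i \<Rightarrow> complex \<Rightarrow> complex) \<Rightarrow> complex \<Rightarrow> 'i set" where
  "near_max I C h z = {i \<in> I. \<forall>j\<in>I. Re (h j z) \<le> Re (h i z) + C}"

text \<open>By contradiction, letting \<open>\<Lambda>\<close> tend to infinity: after division of the \<open>h j\<close> by \<open>\<Lambda>\<close> the error \<open>C\<close>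
  disappears in the limit.\<close>

lemma blow_down:
  fixes I :: "'i set"
  assumes "finite I" "i \<in> I"
  shows "\<forall>\<^sub>F \<Lambda> in at_top. \<forall>h. (\<forall>j\<in>I. h j holomorphic_on ball 0 2) \<longrightarrow>
           (\<forall>z\<in>ball 0 2. card I < 2 * card (near_max I C h z)) \<longrightarrow> i \<in> near_max I C h 0 \<longrightarrow>
           (\<forall>z\<in>ball 0 2. \<forall>j\<in>I. Re (h j z) \<le> Re (h i z) + K * \<Lambda>) \<longrightarrow>
           (\<forall>z\<in>cball 0 1. \<forall>j\<in>I. Re (h j z) \<le> Re (h i z) + \<Lambda>)"
    (is "eventually (\<lambda>\<Lambda>. \<forall>h. ?P h \<Lambda>) at_top")
proof (rule ccontr)
  assume "\<not> ?thesis"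
  \<comment> \<open>The bound \<open>real k + 1\<close> gives both divergence of
    \<open>\<Lambda>\<close> and its positivity for every \<open>k\<close>.\<close>
  then have "\<forall>k::nat. \<exists>\<Lambda>\<ge>real k + 1. \<exists>h. \<not> ?P h \<Lambda>"
    unfolding eventually_at_top_linorder by blast
  then obtain \<Lambda> h where \<Lambda>k: "\<And>k. \<Lambda> k \<ge> real k + 1" and notP: "\<And>k. \<not> ?P (h k) (\<Lambda> k)"
    by metis
  have hol: "h k j holomorphic_on ball 0 2" if "j \<in> I" for k j
    using notP[of k] that by blast
  have maj: "card I < 2 * card (near_max I C (h k) z)" if "z \<in> ball 0 2" for k z
    using notP[of k] that by blast
  have i0: "i \<in> near_max I C (h k) 0" for k
    using notP[of k] by blast
  have up: "Re (h k j z) \<le> Re (h k i z) + K * \<Lambda> k" if "z \<in> ball 0 2" "j \<in> I" for k z j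
    using notP[of k] that by blast
  have bad: "\<not> (\<forall>z\<in>cball 0 1. \<forall>j\<in>I. Re (h k j z) \<le> Re (h k i z) + \<Lambda> k)" for k
    using notP[of k] by blast
  have \<Lambda>pos: "\<Lambda> k > 0" for k using \<Lambda>k[of k] by linarith
  have \<Lambda>lim: "filterlim \<Lambda> at_top sequentially"
  proof (rule filterlim_at_top_mono[OF filterlim_real_sequentially], rule always_eventually, rule allI)
    show "real k \<le> \<Lambda> k" for k using \<Lambda>k[of k] by linarith
  qed
  \<comment> \<open>Subtracting \<open>h k i\<close> makes \<open>F i k\<close> identically 1, and
    the a priori bound \<open>K * \<Lambda> k\<close> becomes the bound \<open>exp K\<close>, which
    is independent of \<open>k\<close> as Montel's theorem requires.\<close>
  define F where "F j k z = exp ((h k j z - h k i z) / of_real (\<Lambda> k))" for j k z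
  have nF: "norm (F j k z) = exp ((Re (h k j z) - Re (h k i z)) / \<Lambda> k)" for j k z
    by (simp add: F_def)
  have holF: "F j k holomorphic_on ball 0 2" if "j \<in> I" for j k
    unfolding F_def by (intro holomorphic_intros hol that assms) (use \<Lambda>pos[of k] in auto)
  have bdF: "norm (F j k z) \<le> exp K" if "j \<in> I" "z \<in> ball 0 2" for j k z
    using up[OF that(2,1), of k] \<Lambda>pos[of k] by (simp add: nF divide_simps)
  obtain r E where r: "strict_mono (r :: nat \<Rightarrow> nat)"
    and rE: "\<forall>j\<in>I. E j holomorphic_on ball 0 2 \<and>
      (\<forall>K. compact K \<longrightarrow> K \<subseteq> ball 0 2 \<longrightarrow> uniform_limit K (\<lambda>k. F j (r k)) (E j) sequentially)"
    using Montel_finite[of I "ball 0 2" F "exp K"] assms(1) holF bdF by auto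
  have holE: "E j holomorphic_on ball 0 2" if "j \<in> I" for j
    using rE that by simp
  have ul: "uniform_limit X (\<lambda>k. F j (r k)) (E j) sequentially"
    if "j \<in> I" "compact X" "X \<subseteq> ball 0 2" for j X
    using rE that by simp
  have pt: "(\<lambda>k. F j (r k) z) \<longlonglongrightarrow> E j z" if "j \<in> I" "z \<in> ball 0 2" for j z
    using tendsto_uniform_limitI[OF ul[OF that(1), of "{z}"]] that(2) by simp
  have "(\<lambda>k. C / \<Lambda> (r k)) \<longlonglongrightarrow> 0"
    using filterlim_compose[OF \<Lambda>lim filterlim_subseq[OF r]]
    by (intro tendsto_divide_0[OF tendsto_const] filterlim_at_top_imp_at_infinity)
  then have expC: "(\<lambda>k. exp (C / \<Lambda> (r k))) \<longlonglongrightarrow> 1"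
    using tendsto_exp by fastforce
  have near: "norm (F l k z) \<le> exp (C / \<Lambda> k) * norm (F j k z)"
    if "j \<in> near_max I C (h k) z" "l \<in> I" for j l k z
    using that \<Lambda>pos[of k] by (simp add: near_max_def nF flip: exp_add add_divide_distrib)
      (simp add: divide_right_mono algebra_simps)
  have Ei: "E i z = 1" if "z \<in> ball 0 2" for z
    using LIMSEQ_unique[OF pt[OF assms(2) that]] by (simp add: F_def)
  obtain s where s: "s \<in> I" and dom: "\<And>z j. z \<in> ball 0 2 \<Longrightarrow> j \<in> I \<Longrightarrow> norm (E j z) \<le> norm (E s z)"
  proof (rule majority_dominant[OF assms(1), of "ball 0 2" E])
    fix z :: complex assume z: "z \<in> ball 0 2"
    define T where "T = {i \<in> I. \<forall>j\<in>I. norm (E j z) \<le> norm (E i z)}"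
    \<comment> \<open>An index beaten in the limit is eventually not near-maximal, since the slack
      \<open>exp (C / \<Lambda> (r k))\<close> tends to 1. For large \<open>k\<close> the
      near-maximal indices therefore lie in \<open>T\<close>, which inherits their majority.\<close>
    have "\<forall>\<^sub>F k in sequentially. j \<notin> near_max I C (h (r k)) z" if j: "j \<in> I - T" for j
    proof -
      obtain l where l: "l \<in> I" "norm (E j z) < norm (E l z)"
        using j by (auto simp: T_def not_le)
      have "(\<lambda>k. norm (F l (r k) z) - exp (C / \<Lambda> (r k)) * norm (F j (r k) z)) \<longlonglongrightarrow>
              norm (E l z) - 1 * norm (E j z)"
        using j by (intro tendsto_intros expC pt l z) auto
      then have "\<forall>\<^sub>F k in sequentially. norm (F l (r k) z) - exp (C / \<Lambda> (r k)) * norm (F j (r k) z) > 0"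
        using l(2) by (intro order_tendstoD(1)) auto
      then show ?thesis
        by (rule eventually_mono) (use near[OF _ l(1)] in fastforce)
    qed
    then have "\<forall>\<^sub>F k in sequentially. \<forall>j\<in>I - T. j \<notin> near_max I C (h (r k)) z"
      by (intro eventually_ball_finite) (use assms(1) in auto)
    then obtain k where "\<forall>j\<in>I - T. j \<notin> near_max I C (h (r k)) z"
      using eventually_happens'[OF sequentially_bot] by blast
    then have "near_max I C (h (r k)) z \<subseteq> T" by (auto simp: near_max_def)
    then have "card (near_max I C (h (r k)) z) \<le> card T"
      using assms(1) by (intro card_mono) (auto simp: T_def)
    then show "card I < 2 * card T" using maj[OF z, of "r k"] by linarith
  qed (use holE in auto)
  have E0: "norm (E j 0) \<le> 1" if "j \<in> I" for j
  proof (rule LIMSEQ_le[OF _ expC])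
    show "(\<lambda>k. norm (F j (r k) 0)) \<longlonglongrightarrow> norm (E j 0)"
      by (intro tendsto_norm pt that) simp
    show "\<exists>N. \<forall>k\<ge>N. norm (F j (r k) 0) \<le> exp (C / \<Lambda> (r k))"
      using near[OF i0 that] by (auto simp: F_def)
  qed
  have Es: "norm (E s z) \<ge> 1" if "z \<in> ball 0 2" for z
    using dom[OF that assms(2)] Ei[OF that] by simp
  \<comment> \<open>\<open>E s\<close> has modulus at least 1 everywhere because it dominates
    \<open>E i = 1\<close>, and at most 1 at the centre because \<open>i\<close> is near-maximal
    there. So \<open>1 / E s\<close> attains its maximal modulus at an interior point.\<close>
  have "(\<lambda>z. 1 / E s z) constant_on ball 0 2"
  proof (rule maximum_modulus_principle[where U = "ball 0 2" and \<xi> = 0])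
    show "(\<lambda>z. 1 / E s z) holomorphic_on ball 0 2"
      by (intro holomorphic_intros holE s) (use Es in fastforce)
    show "norm (1 / E s z) \<le> norm (1 / E s 0)" if "z \<in> ball 0 2" for z
      using Es[OF that] Es[of 0] E0[OF s] by (simp add: norm_divide divide_simps)
  qed auto
  then obtain c where c: "\<And>z. z \<in> ball 0 2 \<Longrightarrow> 1 / E s z = c"
    by (auto simp: constant_on_def)
  have Es1: "norm (E s z) \<le> 1" if "z \<in> ball 0 2" for z
    using c[OF that] c[of 0] E0[OF s] by (metis centre_in_ball divide_cancel_left zero_less_numeral zero_neq_one)
  have "\<forall>\<^sub>F k in sequentially. \<forall>j\<in>I. \<forall>z\<in>cball 0 1. Re (h (r k) j z) \<le> Re (h (r k) i z) + \<Lambda> (r k)"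
  proof (rule eventually_ball_finite[OF assms(1)], rule ballI)
    fix j assume j: "j \<in> I"
    have sub: "cball 0 1 \<subseteq> (ball 0 2 :: complex set)" by (auto simp: subset_eq)
    \<comment> \<open>The limits have modulus at most 1, so an error below \<open>exp 1 - 1\<close>
      keeps \<open>F j (r k)\<close> below \<open>exp 1\<close>; taking logarithms and multiplying
      by \<open>\<Lambda>\<close>, this is the bound that the discs violate.\<close>
    have "\<forall>\<^sub>F k in sequentially. \<forall>z\<in>cball 0 1. dist (F j (r k) z) (E j z) < exp 1 - 1"
      using uniform_limitD[OF ul[OF j compact_cball sub], of "exp 1 - 1"] by simp
    then show "\<forall>\<^sub>F k in sequentially. \<forall>z\<in>cball 0 1. Re (h (r k) j z) \<le> Re (h (r k) i z) + \<Lambda> (r k)"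
    proof (rule eventually_mono, intro ballI)
      fix k z assume k: "\<forall>z\<in>cball 0 1. dist (F j (r k) z) (E j z) < exp 1 - 1"
        and z: "(z::complex) \<in> cball 0 1"
      have "z \<in> ball 0 2" using z sub by blast
      then have "norm (E j z) \<le> 1" using dom[of z j] Es1[of z] j by linarith
      moreover have "norm (F j (r k) z) \<le> dist (F j (r k) z) (E j z) + norm (E j z)"
        using norm_triangle_ineq[of "F j (r k) z - E j z" "E j z"] by (simp add: dist_norm)
      ultimately have "norm (F j (r k) z) < exp 1" using k z by fastforce
      then show "Re (h (r k) j z) \<le> Re (h (r k) i z) + \<Lambda> (r k)"
        using \<Lambda>pos[of "r k"] by (simp add: nF field_simps)
    qed
  qed
  then show False using bad by (auto simp: eventually_sequentially)
qed

lemma near_maxD: "i \<in> near_max I C h z \<Longrightarrow> j \<in> I \<Longrightarrow> Re (h j z) \<le> Re (h i z) + C"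
  and near_max_subset: "near_max I C h z \<subseteq> I"
  by (auto simp: near_max_def)

section \<open>Chains of good discs and descent to smaller bad ones\<close>

text \<open>The segment from \<open>z\<close> to \<open>w\<close> is walked in eight steps. At each
  station a near-maximal index \<open>m\<close> dominates, up to \<open>\<Lambda>\<close>, on the
  disc of radius \<open>R / 2\<close>. There \<open>h m - h i + \<Lambda>\<close> has nonnegative
  real part, so Harnack's inequality controls its growth over one step and with it the loss of
  \<open>h i\<close> against all other indices.\<close>

lemma good_disc_chain:
  fixes h :: "'i \<Rightarrow> complex \<Rightarrow> complex"
  assumes hol: "\<And>j. j \<in> I \<Longrightarrow> h j holomorphic_on ball z (3 * R)"
    and "R > 0" "C \<le> \<Lambda>" "\<Lambda> > 0"
    and good: "\<And>x i w j. dist z x \<le> 2 * R \<Longrightarrow> i \<in> near_max I C h x \<Longrightarrow> dist x w \<le> R / 2 \<Longrightarrow>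
                 j \<in> I \<Longrightarrow> Re (h j w) \<le> Re (h i w) + \<Lambda>"
    and ne: "\<And>x. dist z x \<le> 2 * R \<Longrightarrow> near_max I C h x \<noteq> {}"
    and i: "i \<in> near_max I C h z" and w: "dist z w \<le> 2 * R" and "j \<in> I"
  shows "Re (h j w) \<le> Re (h i w) + 8 ^ 8 * \<Lambda>"
proof -
  have iI: "i \<in> I" by (rule subsetD[OF near_max_subset i])
  \<comment> \<open>Since \<open>w\<close> is within \<open>2 * R\<close>, each of the eight steps
    has length at most \<open>R / 4\<close>, half the radius of the good disc around its starting
    point.\<close>
  define p where "p l = z + of_real (real l / 8) * (w - z)" for l
  have dp: "dist z (p l) \<le> 2 * R" if "l \<le> 8" for l
  proof -
    have "dist z (p l) = real l / 8 * dist z w"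
      by (simp add: p_def dist_norm norm_mult norm_minus_commute norm_divide)
    also have "\<dots> \<le> 1 * (2 * R)" using that w \<open>R > 0\<close> by (intro mult_mono) auto
    finally show ?thesis by simp
  qed
  have "\<forall>j\<in>I. Re (h j (p l)) \<le> Re (h i (p l)) + 8 ^ l * \<Lambda>" if "l \<le> 8" for l
    using that
  proof (induction l)
    case 0
    then show ?case using near_maxD[OF i] \<open>C \<le> \<Lambda>\<close> by (force simp: p_def)
  next
    case (Suc l)
    then have IH: "\<forall>j\<in>I. Re (h j (p l)) \<le> Re (h i (p l)) + 8 ^ l * \<Lambda>" and l: "l \<le> 8" by auto
    obtain m where m: "m \<in> near_max I C h (p l)" using ne[OF dp[OF l]] by blast
    then have mI: "m \<in> I" by (rule subsetD[OF near_max_subset])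
    define q where "q x = h m x - h i x + of_real \<Lambda>" for x
    have sub: "ball (p l) (R / 2) \<subseteq> ball z (3 * R)"
      using dp[OF l] \<open>R > 0\<close> by (simp add: ball_subset_ball_iff dist_commute)
    have step: "p (Suc l) - p l = of_real (1 / 8) * (w - z)"
      by (simp add: p_def field_simps)
    have "norm (p (Suc l) - p l) = norm (w - z) / 8" unfolding step norm_mult norm_of_real by simp
    then have d: "dist (p l) (p (Suc l)) \<le> (R / 2) / 2"
      using w by (simp add: dist_norm norm_minus_commute)
    have "Re (q (p (Suc l))) \<le> 3 * Re (q (p l))"
    proof (rule harnack_half[OF _ _ d])
      show "q holomorphic_on ball (p l) (R / 2)"
        unfolding q_def by (intro holomorphic_intros holomorphic_on_subset[OF hol sub] mI iI)
      show "0 \<le> Re (q x)" if "x \<in> ball (p l) (R / 2)" for x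
        using good[OF dp[OF l] m, of x i] iI that by (simp add: q_def)
    qed (use \<open>R > 0\<close> in auto)
    moreover have "Re (h m (p l)) \<le> Re (h i (p l)) + 8 ^ l * \<Lambda>" using IH mI by blast
    moreover have "(1::real) * \<Lambda> \<le> 8 ^ l * \<Lambda>"
      using \<open>\<Lambda> > 0\<close> by (intro mult_right_mono one_le_power) auto
    ultimately have q: "Re (q (p (Suc l))) \<le> 6 * (8 ^ l * \<Lambda>)"
      unfolding q_def by simp
    show ?case
    proof
      fix j assume "j \<in> I"
      then have "Re (h j (p (Suc l))) \<le> Re (h m (p (Suc l))) + \<Lambda>"
        using d \<open>R > 0\<close> by (intro good[OF dp[OF l] m]) auto
      then have "Re (h j (p (Suc l))) \<le> Re (h i (p (Suc l))) + Re (q (p (Suc l)))"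
        by (simp add: q_def)
      moreover have "8 ^ Suc l * \<Lambda> = 8 * (8 ^ l * \<Lambda>)" by simp
      moreover have "0 \<le> 8 ^ l * \<Lambda>" using \<open>\<Lambda> > 0\<close> by simp
      ultimately show "Re (h j (p (Suc l))) \<le> Re (h i (p (Suc l))) + 8 ^ Suc l * \<Lambda>"
        using q by linarith
    qed
  qed
  from this[of 8] \<open>j \<in> I\<close> show ?thesis by (simp add: p_def)
qed

text \<open>The factor \<open>8 ^ 8\<close> is fixed first and \<open>\<Lambda>\<close> is then
  chosen for all indices of the finite set at once, independently of \<open>h\<close>. With this
  \<open>\<Lambda>\<close>, a bad disc all of whose neighbours of half the radius are good would
  satisfy the hypotheses of \<open>blow_down\<close> after rescaling, and its conclusion says that
  the disc is not bad.\<close>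

lemma majority_bound:
  fixes I :: "'i set"
  assumes "finite I"
  shows "\<exists>\<Lambda>>0. \<forall>h. (\<forall>j\<in>I. h j holomorphic_on ball 0 1) \<longrightarrow>
           (\<forall>z\<in>ball 0 1. card I < 2 * card (near_max I C h z)) \<longrightarrow>
           (\<forall>i\<in>near_max I C h 0. \<forall>w\<in>cball 0 (1/16). \<forall>j\<in>I. Re (h j w) \<le> Re (h i w) + \<Lambda>)"
proof -
  define P where "P \<Lambda> i h \<longleftrightarrow> ((\<forall>j\<in>I. h j holomorphic_on ball 0 2) \<longrightarrow>
           (\<forall>z\<in>ball 0 2. card I < 2 * card (near_max I C h z)) \<longrightarrow> i \<in> near_max I C h 0 \<longrightarrow>
           (\<forall>z\<in>ball 0 2. \<forall>j\<in>I. Re (h j z) \<le> Re (h i z) + 8 ^ 8 * \<Lambda>) \<longrightarrow>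
           (\<forall>z\<in>cball 0 1. \<forall>j\<in>I. Re (h j z) \<le> Re (h i z) + \<Lambda>))" for \<Lambda> i h
  have "\<forall>\<^sub>F \<Lambda> in at_top. \<forall>h. P \<Lambda> i h" if "i \<in> I" for i
    unfolding P_def by (rule blow_down[OF assms that])
  then have "\<forall>\<^sub>F \<Lambda> in at_top. \<forall>i\<in>I. \<forall>h. P \<Lambda> i h"
    by (intro eventually_ball_finite assms) auto
  \<comment> \<open>Positivity is for the chain of discs; the strict excess over \<open>C\<close> is
    what excludes very small bad discs by continuity.\<close>
  then have "\<forall>\<^sub>F \<Lambda> in at_top. (\<forall>i\<in>I. \<forall>h. P \<Lambda> i h) \<and> \<Lambda> > max C 0"
    by (intro eventually_conj eventually_gt_at_top)
  then have "\<exists>\<Lambda>. (\<forall>i\<in>I. \<forall>h. P \<Lambda> i h) \<and> \<Lambda> > max C 0"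
    by (rule eventually_happens'[OF trivial_limit_at_top_linorder])
  then obtain \<Lambda> where \<Lambda>: "\<And>i h. i \<in> I \<Longrightarrow> P \<Lambda> i h" "\<Lambda> > C" "\<Lambda> > 0"
    by (auto simp only: max_less_iff_conj)
  show ?thesis
  proof (intro exI conjI allI impI, rule \<Lambda>(3), rule ccontr)
    fix h :: "'i \<Rightarrow> complex \<Rightarrow> complex"
    assume hol: "\<forall>j\<in>I. h j holomorphic_on ball 0 1"
      and maj: "\<forall>z\<in>ball 0 1. card I < 2 * card (near_max I C h z)"
    define bad where "bad z R \<longleftrightarrow> (\<exists>i\<in>near_max I C h z. \<exists>w. dist z w \<le> R \<and>
      (\<exists>j\<in>I. Re (h i w) + \<Lambda> < Re (h j w)))" for z R
    have ne: "near_max I C h z \<noteq> {}" if "z \<in> ball 0 1" for z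
    proof
      assume "near_max I C h z = {}"
      moreover have "card I < 2 * card (near_max I C h z)" using maj that by blast
      ultimately show False by simp
    qed
    \<comment> \<open>Centres within 1/4 and radii up to 1/16 keep \<open>ball z (3 * R)\<close>,
      where the chain argument takes place, inside the unit disc.\<close>
    have descend: "\<exists>x. dist z x \<le> 2 * R \<and> bad x (R / 2)"
      if z: "norm z \<le> 1 / 4" and R: "0 < R" "R \<le> 1 / 16" and bd: "bad z R" for z R
    proof (rule ccontr)
      assume no: "\<not> ?thesis"
      obtain i w j where i: "i \<in> near_max I C h z" and w: "dist z w \<le> R" and j: "j \<in> I"
        and gt: "Re (h i w) + \<Lambda> < Re (h j w)"
        using bd by (auto simp: bad_def)
      have sub: "ball z (3 * R) \<subseteq> ball 0 1"
        using z R by (simp add: ball_subset_ball_iff)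
      have inb: "x \<in> ball 0 1" if "dist z x \<le> 2 * R" for x
        using that sub R by (auto simp: subset_eq)
      have chain: "Re (h k x) \<le> Re (h i x) + 8 ^ 8 * \<Lambda>" if "dist z x \<le> 2 * R" "k \<in> I" for x k
      proof (rule good_disc_chain[OF _ R(1) _ \<Lambda>(3) _ _ i that])
        show "h j holomorphic_on ball z (3 * R)" if "j \<in> I" for j
          using hol that sub holomorphic_on_subset by blast
        show "Re (h j w) \<le> Re (h i w) + \<Lambda>"
          if "dist z x \<le> 2 * R" "i \<in> near_max I C h x" "dist x w \<le> R / 2" "j \<in> I" for x i w j
        proof (rule ccontr)
          assume "\<not> Re (h j w) \<le> Re (h i w) + \<Lambda>"
          then have "Re (h i w) + \<Lambda> < Re (h j w)" by simp
          then have "bad x (R / 2)" unfolding bad_def using that by blast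
          then show False using no that(1) by blast
        qed
        show "near_max I C h x \<noteq> {}" if "dist z x \<le> 2 * R" for x
          by (rule ne[OF inb[OF that]])
      qed (use \<Lambda> in auto)
      define g where "g k \<zeta> = h k (z + of_real R * \<zeta>)" for k \<zeta>
      have d: "dist z (z + of_real R * \<zeta>) = R * norm \<zeta>" for \<zeta>
        using R by (simp add: dist_norm norm_mult)
      have nm: "near_max I C g \<zeta> = near_max I C h (z + of_real R * \<zeta>)" for \<zeta>
        by (simp add: near_max_def g_def)
      have "i \<in> I" by (rule subsetD[OF near_max_subset i])
      then have Pg: "P \<Lambda> i g" by (rule \<Lambda>(1))
      have "g k holomorphic_on ball 0 2" if "k \<in> I" for k
        unfolding g_def
      proof (rule holomorphic_on_compose_gen[of "\<lambda>\<zeta>. z + of_real R * \<zeta>" _ "h k" "ball 0 1", unfolded o_def])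
        show "(\<lambda>\<zeta>. z + of_real R * \<zeta>) ` ball 0 2 \<subseteq> ball 0 1"
        proof
          fix y assume "y \<in> (\<lambda>\<zeta>. z + of_real R * \<zeta>) ` ball 0 2"
          then obtain \<zeta> where \<zeta>: "norm \<zeta> < 2" "y = z + of_real R * \<zeta>" by auto
          then have "dist z y \<le> 2 * R" using d[of \<zeta>] R by simp
          then show "y \<in> ball 0 1" by (rule inb)
        qed
      qed (use hol that in \<open>auto intro!: holomorphic_intros\<close>)
      then have g1: "\<forall>k\<in>I. g k holomorphic_on ball 0 2" by blast
      have g2: "\<forall>\<zeta>\<in>ball 0 2. card I < 2 * card (near_max I C g \<zeta>)"
      proof
        fix \<zeta> :: complex assume "\<zeta> \<in> ball 0 2"
        then have "dist z (z + of_real R * \<zeta>) \<le> 2 * R" using d[of \<zeta>] R by simp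
        then show "card I < 2 * card (near_max I C g \<zeta>)" unfolding nm using maj inb by blast
      qed
      have g3: "i \<in> near_max I C g 0" using i by (simp add: nm)
      have g4: "\<forall>\<zeta>\<in>ball 0 2. \<forall>k\<in>I. Re (g k \<zeta>) \<le> Re (g i \<zeta>) + 8 ^ 8 * \<Lambda>"
      proof (intro ballI)
        fix \<zeta> :: complex and k assume "\<zeta> \<in> ball 0 2" "k \<in> I"
        then show "Re (g k \<zeta>) \<le> Re (g i \<zeta>) + 8 ^ 8 * \<Lambda>"
          unfolding g_def using d[of \<zeta>] R by (intro chain) auto
      qed
      have con: "\<forall>\<zeta>\<in>cball 0 1. \<forall>k\<in>I. Re (g k \<zeta>) \<le> Re (g i \<zeta>) + \<Lambda>"
        by (rule Pg[unfolded P_def, THEN mp, THEN mp, THEN mp, THEN mp, OF g1 g2 g3 g4])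
      define \<zeta> where "\<zeta> = (w - z) / of_real R"
      have "\<zeta> \<in> cball 0 1" "z + of_real R * \<zeta> = w"
        using w R by (simp_all add: \<zeta>_def norm_divide dist_norm norm_minus_commute)
      then have "Re (h j w) \<le> Re (h i w) + \<Lambda>" using con j unfolding g_def by force
      then show False using gt by simp
    qed
    txt \<open>Iterated descent produces bad discs of radius tending to 0, which continuity excludes.\<close>
    assume "\<not> (\<forall>i\<in>near_max I C h 0. \<forall>w\<in>cball 0 (1/16). \<forall>j\<in>I. Re (h j w) \<le> Re (h i w) + \<Lambda>)"
    then obtain i w j where "i \<in> near_max I C h 0" "w \<in> cball 0 (1/16)" "j \<in> I"
        "\<not> Re (h j w) \<le> Re (h i w) + \<Lambda>" by blast
    then have bad0: "bad 0 (1 / 16)"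
      unfolding bad_def by (intro bexI[of _ i] exI[of _ w] bexI[of _ j] conjI) auto
    \<comment> \<open>The k-th descent moves the centre by at most
      \<open>1 / 8 * (1 / 2) ^ k\<close>; the partial sums of this geometric series are
      \<open>1 / 4 * (1 - (1 / 2) ^ k)\<close>, so the centres never leave the disc of radius
      1/4.\<close>
    have badk: "\<exists>z. norm z \<le> 1 / 4 * (1 - (1 / 2) ^ k) \<and> bad z (1 / 16 * (1 / 2) ^ k)" for k
    proof (induction k)
      case 0
      then show ?case using bad0 by (intro exI[of _ 0]) simp
    next
      case (Suc k)
      then obtain z where z: "norm z \<le> 1 / 4 * (1 - (1 / 2) ^ k)" "bad z (1 / 16 * (1 / 2) ^ k)"
        by blast
      have k1: "(1 / 2 :: real) ^ k \<le> 1" "(1 / 2 :: real) ^ k > 0" by (auto intro: power_le_one)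
      then have z4: "norm z \<le> 1 / 4" using z by argo
      obtain x where x: "dist z x \<le> 2 * (1 / 16 * (1 / 2) ^ k)" "bad x (1 / 16 * (1 / 2) ^ k / 2)"
        using descend[OF z4 _ _ z(2)] k1 by auto
      have "norm x \<le> norm z + dist z x"
        using norm_triangle_ineq4[of z "z - x"] by (simp add: dist_norm)
      then show ?case using x z by (intro exI[of _ x]) auto
    qed
    \<comment> \<open>From \<open>z\<close> to \<open>w\<close> the gap between \<open>h j\<close>
      and \<open>h i\<close> would have to grow from at most \<open>C\<close> to more than
      \<open>\<Lambda>\<close>, while each of the two functions changes by less than half the
      difference.\<close>
    define e where "e = (\<Lambda> - C) / 2"
    have e: "e > 0" using \<Lambda> by (simp add: e_def)
    \<comment> \<open>Stating the modulus of continuity as an eventual property lets the finitely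
      many indices share a single \<open>\<eta>\<close>.\<close>
    have "\<forall>j\<in>I. \<forall>\<^sub>F \<eta> in at_right 0. \<forall>z\<in>cball 0 (1/2). \<forall>w\<in>cball 0 (1/2).
        dist w z < \<eta> \<longrightarrow> dist (h j w) (h j z) < e"
    proof
      fix j assume j: "j \<in> I"
      have "cball 0 (1/2) \<subseteq> (ball 0 1 :: complex set)" by (auto simp: subset_eq)
      then have "continuous_on (cball 0 (1/2)) (h j)"
        using hol j holomorphic_on_imp_continuous_on holomorphic_on_subset by blast
      then have "uniformly_continuous_on (cball 0 (1/2)) (h j)"
        by (intro compact_uniformly_continuous) auto
      then obtain d where d: "d > 0" "\<And>z w. z \<in> cball 0 (1/2) \<Longrightarrow> w \<in> cball 0 (1/2) \<Longrightarrow>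
          dist w z < d \<Longrightarrow> dist (h j w) (h j z) < e"
        unfolding uniformly_continuous_on_def using e by metis
      then show "\<forall>\<^sub>F \<eta> in at_right 0. \<forall>z\<in>cball 0 (1/2). \<forall>w\<in>cball 0 (1/2).
          dist w z < \<eta> \<longrightarrow> dist (h j w) (h j z) < e"
        by (auto simp: eventually_at_right_field intro!: exI[of _ d])
    qed
    then have "\<forall>\<^sub>F \<eta> in at_right 0. \<forall>j\<in>I. \<forall>z\<in>cball 0 (1/2). \<forall>w\<in>cball 0 (1/2).
        dist w z < \<eta> \<longrightarrow> dist (h j w) (h j z) < e"
      by (rule eventually_ball_finite[OF assms])
    then have "\<forall>\<^sub>F \<eta> in at_right 0. (\<forall>j\<in>I. \<forall>z\<in>cball 0 (1/2). \<forall>w\<in>cball 0 (1/2).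
        dist w z < \<eta> \<longrightarrow> dist (h j w) (h j z) < e) \<and> \<eta> > (0::real)"
      by (rule eventually_conj) (rule eventually_at_right_less)
    then have "\<exists>\<eta>. (\<forall>j\<in>I. \<forall>z\<in>cball 0 (1/2). \<forall>w\<in>cball 0 (1/2).
        dist w z < \<eta> \<longrightarrow> dist (h j w) (h j z) < e) \<and> \<eta> > (0::real)"
      by (rule eventually_happens'[OF trivial_limit_at_right_real])
    then obtain \<eta> where \<eta>: "\<eta> > 0" "\<And>j z w. j \<in> I \<Longrightarrow> z \<in> cball 0 (1/2) \<Longrightarrow> w \<in> cball 0 (1/2) \<Longrightarrow>
        dist w z < \<eta> \<Longrightarrow> dist (h j w) (h j z) < e"
      by blast
    obtain k where k: "(1 / 2 :: real) ^ k < \<eta>"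
      using real_arch_pow_inv[OF \<eta>(1), of "1/2"] by auto
    obtain z where z: "norm z \<le> 1 / 4 * (1 - (1 / 2) ^ k)" "bad z (1 / 16 * (1 / 2) ^ k)"
      using badk by blast
    obtain i w j where i: "i \<in> near_max I C h z" and w: "dist z w \<le> 1 / 16 * (1 / 2) ^ k"
      and j: "j \<in> I" and gt: "Re (h i w) + \<Lambda> < Re (h j w)"
      using z(2) by (auto simp: bad_def)
    have k1: "(1 / 2 :: real) ^ k \<le> 1" "(1 / 2 :: real) ^ k > 0" by (auto intro: power_le_one)
    have nw: "norm w \<le> norm z + dist z w"
      using norm_triangle_ineq4[of z "z - w"] by (simp add: dist_norm)
    define t :: real where "t = (1 / 2) ^ k"
    have t: "0 < t" "t \<le> 1" "t < \<eta>" "norm z \<le> 1 / 4 * (1 - t)" "dist z w \<le> 1 / 16 * t"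
      using k k1 z(1) w unfolding t_def by blast+
    have "norm z \<le> 1 / 2" using t by argo
    moreover have "norm w \<le> 1 / 2" using t nw by argo
    moreover have "dist w z < \<eta>" using t unfolding dist_commute[of w z] by argo
    ultimately have zw: "z \<in> cball 0 (1/2)" "w \<in> cball 0 (1/2)" "dist w z < \<eta>"
      by simp_all
    have close: "\<bar>Re (h m w) - Re (h m z)\<bar> < e" if "m \<in> I" for m
      using \<eta>(2)[OF that zw] abs_Re_le_cmod[of "h m w - h m z"] by (simp add: dist_norm)
    have "i \<in> I" by (rule subsetD[OF near_max_subset i])
    then show False
      using near_maxD[OF i j] close[of i] close[OF j] gt unfolding e_def abs_less_iff by argo
  qed
qed

section \<open>Domination among zero-free functions\<close>

text \<open>Quantifying over \<open>F\<close> inside the predicate records that \<open>M\<close> is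
  uniform in the functions; the radius 1/16 is that of \<open>majority_bound\<close>.\<close>

definition dominance_constant :: "'i set \<Rightarrow> real \<Rightarrow> real \<Rightarrow> bool" where
  "dominance_constant I C M \<longleftrightarrow> (\<forall>F :: 'i \<Rightarrow> complex \<Rightarrow> complex.
     (\<forall>j\<in>I. F j holomorphic_on ball 0 1) \<longrightarrow> (\<forall>j\<in>I. \<forall>z\<in>ball 0 1. F j z \<noteq> 0) \<longrightarrow>
     (\<forall>z\<in>ball 0 1. card I < 2 * card {i \<in> I. \<forall>j\<in>I. cmod (F j z) \<le> C * cmod (F i z)}) \<longrightarrow>
     (\<forall>i\<in>I. (\<forall>j\<in>I. cmod (F j 0) \<le> C * cmod (F i 0)) \<longrightarrow>
        (\<forall>w j. norm w \<le> 1 / 16 \<longrightarrow> j \<in> I \<longrightarrow> cmod (F j w) \<le> M * cmod (F i w))))"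

lemma dominance_constantD:
  assumes "dominance_constant I C M" "\<And>j. j \<in> I \<Longrightarrow> F j holomorphic_on ball 0 1"
    "\<And>j z. j \<in> I \<Longrightarrow> z \<in> ball 0 1 \<Longrightarrow> F j z \<noteq> 0"
    "\<And>z. z \<in> ball 0 1 \<Longrightarrow> card I < 2 * card {i \<in> I. \<forall>j\<in>I. cmod (F j z) \<le> C * cmod (F i z)}"
    "i \<in> I" "\<And>j. j \<in> I \<Longrightarrow> cmod (F j 0) \<le> C * cmod (F i 0)" "norm w \<le> 1 / 16" "j \<in> I"
  shows "cmod (F j w) \<le> M * cmod (F i w)"
  using assms unfolding dominance_constant_def by simp

text \<open>Zero-free functions on a disc have holomorphic logarithms. Moduli become real parts, the
  factor \<open>C\<close> becomes the slack \<open>ln C\<close>, and the additive bound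
  \<open>\<Lambda>\<close> returns as the factor \<open>exp \<Lambda>\<close>.\<close>

lemma dominance_constant_exists:
  fixes I :: "'i set"
  assumes "finite I" "C > 0"
  shows "\<exists>M>0. dominance_constant I C M"
proof -
  obtain \<Lambda> where \<Lambda>: "\<And>h. \<forall>j\<in>I. h j holomorphic_on ball 0 1 \<Longrightarrow>
       \<forall>z\<in>ball 0 1. card I < 2 * card (near_max I (ln C) h z) \<Longrightarrow>
       \<forall>i\<in>near_max I (ln C) h 0. \<forall>w\<in>cball 0 (1/16). \<forall>j\<in>I. Re (h j w) \<le> Re (h i w) + \<Lambda>"
    using majority_bound[OF assms(1), of "ln C"] by metis
  show ?thesis
    unfolding dominance_constant_def
  proof (intro exI[of _ "exp \<Lambda>"] conjI allI ballI impI)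
    show "exp \<Lambda> > 0" by simp
    fix F :: "'i \<Rightarrow> complex \<Rightarrow> complex" and i j and w :: complex
    assume hol': "\<forall>j\<in>I. F j holomorphic_on ball 0 1"
      and nz': "\<forall>j\<in>I. \<forall>z\<in>ball 0 1. F j z \<noteq> 0"
      and maj: "\<forall>z\<in>ball 0 1. card I < 2 * card {i \<in> I. \<forall>j\<in>I. cmod (F j z) \<le> C * cmod (F i z)}"
      and i: "i \<in> I" "\<forall>j\<in>I. cmod (F j 0) \<le> C * cmod (F i 0)"
      and w: "norm w \<le> 1 / 16" and j: "j \<in> I"
    have hol: "F j holomorphic_on ball 0 1" if "j \<in> I" for j using hol' that by blast
    have nz: "F j z \<noteq> 0" if "j \<in> I" "z \<in> ball 0 1" for j z using nz' that by blast
    have "\<exists>h. h holomorphic_on ball 0 1 \<and> (\<forall>z\<in>ball 0 1. F j z = exp (h z))" if j: "j \<in> I" for j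
      using contractible_imp_holomorphic_log[OF hol[OF j] convex_imp_contractible[OF convex_ball] nz[OF j]]
      by metis
    then obtain h where h: "\<And>j. j \<in> I \<Longrightarrow> h j holomorphic_on ball 0 1"
      "\<And>j z. j \<in> I \<Longrightarrow> z \<in> ball 0 1 \<Longrightarrow> F j z = exp (h j z)"
      by metis
    have nF: "cmod (F j z) = exp (Re (h j z))" if "j \<in> I" "z \<in> ball 0 1" for j z
      using h(2)[OF that] by simp
    have cmp: "cmod (F j z) \<le> C * cmod (F i z) \<longleftrightarrow> Re (h j z) \<le> Re (h i z) + ln C"
      if "i \<in> I" "j \<in> I" "z \<in> ball 0 1" for i j z
    proof -
      have "C * cmod (F i z) = exp (Re (h i z) + ln C)"
        using nF[OF that(1,3)] assms(2) by (simp add: exp_add)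
      then show ?thesis using nF[OF that(2,3)] by simp
    qed
    have nm: "near_max I (ln C) h z = {i \<in> I. \<forall>j\<in>I. cmod (F j z) \<le> C * cmod (F i z)}"
      if "z \<in> ball 0 1" for z
      unfolding near_max_def using cmp that by blast
    have "\<forall>z\<in>ball 0 1. card I < 2 * card (near_max I (ln C) h z)"
    proof
      fix z :: complex assume z: "z \<in> ball 0 1"
      show "card I < 2 * card (near_max I (ln C) h z)" unfolding nm[OF z] by (rule bspec[OF maj z])
    qed
    moreover have "i \<in> near_max I (ln C) h 0" using nm[of 0] i by simp
    ultimately have "Re (h j w) \<le> Re (h i w) + \<Lambda>" using \<Lambda>[of h] h(1) w j by simp
    then have "exp (Re (h j w)) \<le> exp \<Lambda> * exp (Re (h i w))"
      by (simp flip: exp_add add: add.commute)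
    moreover have "w \<in> ball 0 1" using w by simp
    ultimately show "cmod (F j w) \<le> exp \<Lambda> * cmod (F i w)" using nF i(1) j by simp
  qed
qed

section \<open>Holomorphic functions of several variables\<close>

lemma holomorphic_funI:
  assumes "\<And>z. z \<in> U \<Longrightarrow> \<exists>V. open V \<and> z \<in> V \<and> holomorphic_fun V g"
  shows "holomorphic_fun U g"
  unfolding holomorphic_fun_def
proof
  fix z assume "z \<in> U"
  then obtain V where "z \<in> V" "holomorphic_fun V g" using assms by blast
  then show "\<exists>g'. (g has_derivative g') (at z) \<and> (\<forall>c v. g' (c *s v) = c * g' v)"
    unfolding holomorphic_fun_def by blast
qed

lemma holomorphic_fun_subset: "holomorphic_fun V g \<Longrightarrow> U \<subseteq> V \<Longrightarrow> holomorphic_fun U g"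
  unfolding holomorphic_fun_def by blast

lemma holomorphic_fun_cong:
  assumes "open U" "holomorphic_fun U g" "\<And>z. z \<in> U \<Longrightarrow> g z = h z"
  shows "holomorphic_fun U h"
  unfolding holomorphic_fun_def
proof
  fix z assume z: "z \<in> U"
  then obtain g' where g': "(g has_derivative g') (at z)" "\<forall>c v. g' (c *s v) = c * g' v"
    using assms(2) unfolding holomorphic_fun_def by blast
  have "(h has_derivative g') (at z)"
    by (rule has_derivative_transform_within_open[OF g'(1) assms(1) z assms(3)])
  with g'(2) show "\<exists>h'. (h has_derivative h') (at z) \<and> (\<forall>c v. h' (c *s v) = c * h' v)" by blast
qed

lemma holomorphic_fun_const [simp]: "holomorphic_fun U (\<lambda>z. c)"
  unfolding holomorphic_fun_def by (intro ballI exI[of _ "\<lambda>_. 0"]) auto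

lemma holomorphic_fun_add:
  assumes "holomorphic_fun U g" "holomorphic_fun U h"
  shows "holomorphic_fun U (\<lambda>z. g z + h z)"
  unfolding holomorphic_fun_def
proof
  fix z assume "z \<in> U"
  then obtain g' h' where "(g has_derivative g') (at z)" "\<forall>c v. g' (c *s v) = c * g' v"
    "(h has_derivative h') (at z)" "\<forall>c v. h' (c *s v) = c * h' v"
    using assms unfolding holomorphic_fun_def by metis
  then show "\<exists>f'. ((\<lambda>z. g z + h z) has_derivative f') (at z) \<and> (\<forall>c v. f' (c *s v) = c * f' v)"
    by (intro exI[of _ "\<lambda>v. g' v + h' v"]) (auto intro!: has_derivative_add simp: algebra_simps)
qed

lemma holomorphic_fun_mult:
  assumes "holomorphic_fun U g" "holomorphic_fun U h"
  shows "holomorphic_fun U (\<lambda>z. g z * h z)"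
  unfolding holomorphic_fun_def
proof
  fix z assume "z \<in> U"
  then obtain g' h' where d: "(g has_derivative g') (at z)" "\<forall>c v. g' (c *s v) = c * g' v"
    "(h has_derivative h') (at z)" "\<forall>c v. h' (c *s v) = c * h' v"
    using assms unfolding holomorphic_fun_def by metis
  show "\<exists>f'. ((\<lambda>z. g z * h z) has_derivative f') (at z) \<and> (\<forall>c v. f' (c *s v) = c * f' v)"
    by (rule exI[of _ "\<lambda>v. g z * h' v + g' v * h z"])
       (use has_derivative_mult[OF d(1,3)] d(2,4) in \<open>auto simp: algebra_simps\<close>)
qed

lemma holomorphic_fun_inverse:
  assumes "holomorphic_fun U g" "\<And>z. z \<in> U \<Longrightarrow> g z \<noteq> 0"
  shows "holomorphic_fun U (\<lambda>z. inverse (g z))"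
  unfolding holomorphic_fun_def
proof
  fix z assume z: "z \<in> U"
  then obtain g' where d: "(g has_derivative g') (at z)" "\<forall>c v. g' (c *s v) = c * g' v"
    using assms(1) unfolding holomorphic_fun_def by metis
  show "\<exists>f'. ((\<lambda>z. inverse (g z)) has_derivative f') (at z) \<and> (\<forall>c v. f' (c *s v) = c * f' v)"
    by (rule exI[of _ "\<lambda>v. - (inverse (g z) * g' v * inverse (g z))"])
       (use Deriv.has_derivative_inverse[OF assms(2)[OF z] d(1)] d(2) in auto)
qed

lemma holomorphic_fun_divide:
  assumes "holomorphic_fun U g" "holomorphic_fun U h" "\<And>z. z \<in> U \<Longrightarrow> h z \<noteq> 0"
  shows "holomorphic_fun U (\<lambda>z. g z / h z)"
  using holomorphic_fun_mult[OF assms(1) holomorphic_fun_inverse[OF assms(2,3)]]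
  by (simp add: divide_inverse)

lemma holomorphic_fun_diff:
  assumes "holomorphic_fun U g" "holomorphic_fun U h"
  shows "holomorphic_fun U (\<lambda>z. g z - h z)"
  using holomorphic_fun_add[OF assms(1) holomorphic_fun_mult[OF holomorphic_fun_const[of U "-1"] assms(2)]]
  by simp

lemma holomorphic_fun_sum:
  "(\<And>i. i \<in> I \<Longrightarrow> holomorphic_fun U (g i)) \<Longrightarrow> holomorphic_fun U (\<lambda>z. \<Sum>i\<in>I. g i z)"
  by (induction I rule: infinite_finite_induct) (auto intro: holomorphic_fun_add)

lemma holomorphic_fun_prod:
  "(\<And>i. i \<in> I \<Longrightarrow> holomorphic_fun U (g i)) \<Longrightarrow> holomorphic_fun U (\<lambda>z. \<Prod>i\<in>I. g i z)"
  by (induction I rule: infinite_finite_induct) (auto intro: holomorphic_fun_mult)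

lemma holomorphic_fun_det:
  fixes A :: "complex ^ 'm \<Rightarrow> complex ^ 'k ^ 'k"
  assumes "\<And>i j. holomorphic_fun U (\<lambda>z. A z $ i $ j)"
  shows "holomorphic_fun U (\<lambda>z. det (A z))"
  unfolding det_def
  by (intro holomorphic_fun_sum holomorphic_fun_mult holomorphic_fun_const holomorphic_fun_prod assms)

lemma holomorphic_fun_pairing:
  assumes "\<And>i. holomorphic_fun U (\<lambda>z. g z $ i)" "\<And>i. holomorphic_fun U (\<lambda>z. h z $ i)"
  shows "holomorphic_fun U (\<lambda>z. pairing (g z) (h z))"
  unfolding pairing_def by (intro holomorphic_fun_sum holomorphic_fun_mult assms)

lemma holomorphic_fun_line:
  fixes g :: "complex ^ 'm \<Rightarrow> complex"
  assumes "(g has_derivative g') (at (x + \<zeta> *s v))" "\<And>c v. g' (c *s v) = c * g' v"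
  shows "((\<lambda>\<zeta>. g (x + \<zeta> *s v)) has_field_derivative g' v) (at \<zeta>)"
proof -
  have bl: "bounded_linear (\<lambda>\<zeta>. \<zeta> *s v)"
  proof
    show "\<exists>K. \<forall>x. norm (x *s v) \<le> norm x * K"
      by (intro exI[of _ "norm v"]) (simp add: norm_cscale)
  qed (auto simp: vec_eq_iff algebra_simps)
  have "((\<lambda>\<zeta>. x + \<zeta> *s v) has_derivative (\<lambda>\<zeta>. 0 + \<zeta> *s v)) (at \<zeta>)"
    by (intro has_derivative_add has_derivative_const bounded_linear_imp_has_derivative bl)
  then have "((\<lambda>\<zeta>. g (x + \<zeta> *s v)) has_derivative (\<lambda>\<zeta>. g' (0 + \<zeta> *s v))) (at \<zeta>)"
    by (rule has_derivative_compose) (use assms(1) in simp)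
  moreover have "(\<lambda>\<zeta>. g' (0 + \<zeta> *s v)) = (*) (g' v)"
    by (simp add: fun_eq_iff assms(2))
  ultimately show ?thesis unfolding has_field_derivative_def by simp
qed

lemma holomorphic_on_line:
  assumes "holomorphic_fun U g" "open S" "\<And>\<zeta>. \<zeta> \<in> S \<Longrightarrow> x + \<zeta> *s v \<in> U"
  shows "(\<lambda>\<zeta>. g (x + \<zeta> *s v)) holomorphic_on S"
  unfolding holomorphic_on_open[OF assms(2)]
proof (intro allI ballI)
  fix \<zeta> assume "\<zeta> \<in> S"
  then obtain g' where "(g has_derivative g') (at (x + \<zeta> *s v))" "\<forall>c v. g' (c *s v) = c * g' v"
    using assms unfolding holomorphic_fun_def by metis
  then show "\<exists>f'. ((\<lambda>\<zeta>. g (x + \<zeta> *s v)) has_field_derivative f') (at \<zeta>)"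
    using holomorphic_fun_line by blast
qed

section \<open>Cauchy estimates and uniform limits in several variables\<close>

text \<open>The one-variable Cauchy inequality on the complex line through \<open>x\<close> in
  direction \<open>v\<close>. The parameter radius is halved, whence the 2, so that the closed disc
  stays inside the open ball.\<close>

lemma cauchy_estimate:
  assumes hol: "holomorphic_fun (ball x \<rho>) g" and "\<rho> > 0"
    and bd: "\<And>z. z \<in> ball x \<rho> \<Longrightarrow> norm (g z) \<le> M"
    and der: "(g has_derivative g') (at x)"
  shows "norm (g' v) \<le> 2 * M / \<rho> * norm v"
proof (cases "v = 0")
  case True
  then show ?thesis using has_derivative_bounded_linear[OF der] linear_simps(3) by auto
next
  case False
  obtain h' where h': "(g has_derivative h') (at x)" "\<And>c v. h' (c *s v) = c * h' v"
    using hol \<open>\<rho> > 0\<close> unfolding holomorphic_fun_def by (meson centre_in_ball)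
  have "g' = h'" using has_derivative_unique der h' by blast
  define R where "R = \<rho> / (2 * norm v)"
  have R: "R > 0" using False \<open>\<rho> > 0\<close> by (simp add: R_def)
  define \<phi> where "\<phi> \<zeta> = g (x + \<zeta> *s v)" for \<zeta>
  have inb: "x + \<zeta> *s v \<in> ball x \<rho>" if "norm \<zeta> < 2 * R" for \<zeta>
    using that False by (simp add: R_def dist_norm norm_cscale field_simps)
  have hol\<phi>: "\<phi> holomorphic_on ball 0 (2 * R)"
    unfolding \<phi>_def by (rule holomorphic_on_line[OF hol]) (use inb in auto)
  have sub: "cball 0 R \<subseteq> ball (0::complex) (2 * R)" using R by (auto simp: subset_eq)
  have "norm ((deriv ^^ 1) \<phi> 0) \<le> fact 1 * M / R ^ 1"
  proof (rule Cauchy_inequality)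
    show "\<phi> holomorphic_on ball 0 R"
      using holomorphic_on_subset[OF hol\<phi>] sub ball_subset_cball by blast
    show "continuous_on (cball 0 R) \<phi>"
      using holomorphic_on_imp_continuous_on[OF holomorphic_on_subset[OF hol\<phi> sub]] .
    show "norm (\<phi> \<zeta>) \<le> M" if "norm (0 - \<zeta>) = R" for \<zeta>
      unfolding \<phi>_def using that R by (intro bd inb) auto
  qed (rule R)
  moreover have "deriv \<phi> 0 = h' v"
    unfolding \<phi>_def by (intro DERIV_imp_deriv holomorphic_fun_line) (use h' in auto)
  ultimately show ?thesis using \<open>g' = h'\<close> by (simp add: R_def mult_ac)
qed

text \<open>Every point of the convex half ball is the centre of a ball of radius
  \<open>\<rho> / 2\<close> inside the large one. The derivative is thus bounded by
  \<open>2 * M / (\<rho> / 2)\<close>, and the mean value inequality applies.\<close>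

lemma cauchy_lipschitz:
  assumes hol: "holomorphic_fun (ball z \<rho>) g" and "\<rho> > 0"
    and bd: "\<And>w. w \<in> ball z \<rho> \<Longrightarrow> norm (g w) \<le> M"
    and xy: "x \<in> ball z (\<rho> / 2)" "y \<in> ball z (\<rho> / 2)"
  shows "norm (g x - g y) \<le> 4 * M / \<rho> * norm (x - y)"
proof -
  have sub: "ball w (\<rho> / 2) \<subseteq> ball z \<rho>" if "w \<in> ball z (\<rho> / 2)" for w
    using that \<open>\<rho> > 0\<close> by (simp add: ball_subset_ball_iff dist_commute)
  have "\<exists>g'. (g has_derivative g') (at w)" if "w \<in> ball z (\<rho> / 2)" for w
    using hol sub[OF that] \<open>\<rho> > 0\<close> that unfolding holomorphic_fun_def
    by (meson centre_in_ball half_gt_zero subsetD)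
  then obtain g' where g': "\<And>w. w \<in> ball z (\<rho> / 2) \<Longrightarrow> (g has_derivative g' w) (at w)"
    by metis
  show ?thesis
  proof (rule differentiable_bound[OF convex_ball _ _ xy, where f' = g'])
    fix w assume w: "w \<in> ball z (\<rho> / 2)"
    show "(g has_derivative g' w) (at w within ball z (\<rho> / 2))"
      using g'[OF w] has_derivative_at_withinI by blast
    show "onorm (g' w) \<le> 4 * M / \<rho>"
    proof (rule onorm_le)
      fix v
      have "norm (g' w v) \<le> 2 * M / (\<rho> / 2) * norm v"
        using sub[OF w] \<open>\<rho> > 0\<close>
        by (intro cauchy_estimate[OF holomorphic_fun_subset[OF hol] _ bd g'[OF w]]) auto
      then show "norm (g' w v) \<le> 4 * M / \<rho> * norm v" by simp
    qed
  qed
qed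

lemma cauchy_lipschitz_vec:
  fixes g :: "complex ^ 'm \<Rightarrow> complex ^ 'k"
  assumes hol: "\<And>i. holomorphic_fun (ball z \<rho>) (\<lambda>w. g w $ i)" and "\<rho> > 0"
    and bd: "\<And>w. w \<in> ball z \<rho> \<Longrightarrow> norm (g w) \<le> M"
    and xy: "x \<in> ball z (\<rho> / 2)" "y \<in> ball z (\<rho> / 2)"
  shows "norm (g x - g y) \<le> real CARD('k) * (4 * M / \<rho> * norm (x - y))"
proof -
  have "norm (g x - g y) \<le> (\<Sum>i\<in>UNIV. norm ((g x - g y) $ i))"
    unfolding norm_vec_def by (rule L2_set_le_sum) simp
  also have "\<dots> \<le> (\<Sum>i\<in>(UNIV::'k set). 4 * M / \<rho> * norm (x - y))"
  proof (rule sum_mono)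
    fix i
    have "norm (g w $ i) \<le> M" if "w \<in> ball z \<rho>" for w
      using bd[OF that] Finite_Cartesian_Product.norm_nth_le[of "g w" i] by linarith
    then show "norm ((g x - g y) $ i) \<le> 4 * M / \<rho> * norm (x - y)"
      using cauchy_lipschitz[OF hol[of i] \<open>\<rho> > 0\<close> _ xy, of M] by simp
  qed
  finally show ?thesis by simp
qed

text \<open>Cauchy's estimate for the differences \<open>g m - g n\<close> makes the derivatives
  uniformly Cauchy on the half ball, so differentiation commutes with the limit. Complex linearity
  of the derivative passes to pointwise limits.\<close>

lemma holomorphic_fun_uniform_limit:
  fixes g :: "nat \<Rightarrow> complex ^ 'm \<Rightarrow> complex"
  assumes hol: "\<And>n. holomorphic_fun (ball z \<rho>) (g n)" and \<rho>: "\<rho> > 0"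
    and ul: "uniform_limit (ball z \<rho>) g f sequentially"
  shows "holomorphic_fun (ball z (\<rho> / 2)) f"
proof -
  let ?S = "ball z (\<rho> / 2)"
  have sub: "ball w (\<rho> / 2) \<subseteq> ball z \<rho>" if "w \<in> ?S" for w
    using that \<rho> by (simp add: ball_subset_ball_iff dist_commute)
  have "\<forall>n w. \<exists>g'. w \<in> ?S \<longrightarrow> (g n has_derivative g') (at w) \<and> (\<forall>c v. g' (c *s v) = c * g' v)"
    using hol sub \<rho> unfolding holomorphic_fun_def by (meson centre_in_ball half_gt_zero subsetD)
  then obtain D where D: "\<And>n w. w \<in> ?S \<Longrightarrow> (g n has_derivative D n w) (at w)"
    "\<And>n w c v. w \<in> ?S \<Longrightarrow> D n w (c *s v) = c * D n w v"
    by metis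
  have est: "\<exists>N. \<forall>m\<ge>N. \<forall>n\<ge>N. \<forall>w\<in>?S. \<forall>v. norm (D m w v - D n w v) \<le> e * norm v" if e: "e > 0" for e
  proof -
    \<comment> \<open>Differences are bounded by \<open>2 * d\<close> on balls of radius
      \<open>\<rho> / 2\<close>, so the Cauchy estimate reads
      \<open>2 * (2 * d) / (\<rho> / 2) = e\<close>.\<close>
    define d where "d = e * \<rho> / 8"
    have d: "d > 0" using e \<rho> by (simp add: d_def)
    obtain N where N: "\<And>n w. n \<ge> N \<Longrightarrow> w \<in> ball z \<rho> \<Longrightarrow> dist (g n w) (f w) < d"
      using ul d unfolding uniform_limit_sequentially_iff by metis
    have "norm (D m w v - D n w v) \<le> e * norm v" if "m \<ge> N" "n \<ge> N" "w \<in> ?S" for m n w v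
    proof -
      have "norm (D m w v - D n w v) \<le> 2 * (2 * d) / (\<rho> / 2) * norm v"
      proof (rule cauchy_estimate[where g = "\<lambda>w. g m w - g n w" and g' = "\<lambda>v. D m w v - D n w v"])
        show "holomorphic_fun (ball w (\<rho> / 2)) (\<lambda>w. g m w - g n w)"
          by (intro holomorphic_fun_diff holomorphic_fun_subset[OF hol] sub that)
        show "norm (g m y - g n y) \<le> 2 * d" if "y \<in> ball w (\<rho> / 2)" for y
        proof -
          have y: "y \<in> ball z \<rho>" using that sub[OF \<open>w \<in> ?S\<close>] by blast
          have "dist (g m y) (g n y) \<le> dist (g m y) (f y) + dist (g n y) (f y)"
            by (rule dist_triangle2)
          then show ?thesis using N[OF \<open>m \<ge> N\<close> y] N[OF \<open>n \<ge> N\<close> y] by (simp add: dist_norm)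
        qed
        show "((\<lambda>w. g m w - g n w) has_derivative (\<lambda>v. D m w v - D n w v)) (at w)"
          by (intro has_derivative_diff D that)
      qed (use \<rho> in auto)
      then show ?thesis using \<rho> by (simp add: d_def)
    qed
    then show ?thesis by blast
  qed
  define D' where "D' w v = lim (\<lambda>n. D n w v)" for w v
  have lim: "(\<lambda>n. D n w v) \<longlonglongrightarrow> D' w v" if w: "w \<in> ?S" for w v
  proof -
    have "Cauchy (\<lambda>n. D n w v)"
    proof (rule metric_CauchyI)
      fix e :: real assume e: "e > 0"
      have e': "e / (norm v + 1) > 0" using e by (simp add: add_nonneg_pos)
      obtain N where N: "\<And>m n. m \<ge> N \<Longrightarrow> n \<ge> N \<Longrightarrow> norm (D m w v - D n w v) \<le> e / (norm v + 1) * norm v"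
        using est[OF e'] w by blast
      have "e / (norm v + 1) * norm v < e"
        using e by (simp add: divide_less_eq add_nonneg_pos)
      then show "\<exists>N. \<forall>m\<ge>N. \<forall>n\<ge>N. dist (D m w v) (D n w v) < e"
        using N unfolding dist_norm by (meson le_less_trans)
    qed
    then show ?thesis unfolding D'_def by (metis Cauchy_convergent_iff convergent_LIMSEQ_iff)
  qed
  have "\<exists>h. \<forall>w\<in>?S. (\<lambda>n. g n w) \<longlonglongrightarrow> h w \<and> (h has_derivative D' w) (at w within ?S)"
  proof (rule has_derivative_sequence[OF convex_ball])
    show "(g n has_derivative D n w) (at w within ?S)" if "w \<in> ?S" for n w
      using D(1)[OF that] has_derivative_at_withinI by blast
    show "\<forall>\<^sub>F n in sequentially. \<forall>w\<in>?S. \<forall>v. norm (D n w v - D' w v) \<le> e * norm v" if "e > 0" for e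
    proof -
      obtain N where N: "\<forall>m\<ge>N. \<forall>n\<ge>N. \<forall>w\<in>?S. \<forall>v. norm (D m w v - D n w v) \<le> e * norm v"
        using est[OF \<open>e > 0\<close>] by blast
      have "norm (D n w v - D' w v) \<le> e * norm v" if "n \<ge> N" "w \<in> ?S" for n w v
      proof (rule LIMSEQ_le_const2)
        show "(\<lambda>m. norm (D n w v - D m w v)) \<longlonglongrightarrow> norm (D n w v - D' w v)"
          by (intro tendsto_intros lim that)
        show "\<exists>N. \<forall>m\<ge>N. norm (D n w v - D m w v) \<le> e * norm v" using N that by blast
      qed
      then show ?thesis unfolding eventually_sequentially by blast
    qed
    show "z \<in> ?S" using \<rho> by simp
    show "(\<lambda>n. g n z) \<longlonglongrightarrow> f z"
      by (rule tendsto_uniform_limitI[OF ul]) (use \<rho> in simp)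
  qed
  then obtain h where h: "\<And>w. w \<in> ?S \<Longrightarrow> (\<lambda>n. g n w) \<longlonglongrightarrow> h w"
    "\<And>w. w \<in> ?S \<Longrightarrow> (h has_derivative D' w) (at w within ?S)"
    by blast
  have fh: "h w = f w" if "w \<in> ?S" for w
  proof (rule LIMSEQ_unique[OF h(1)[OF that] tendsto_uniform_limitI[OF ul]])
    show "w \<in> ball z \<rho>" using that \<rho> by auto
  qed
  have "holomorphic_fun ?S h"
    unfolding holomorphic_fun_def
  proof (intro ballI exI conjI allI)
    fix w c v assume w: "w \<in> ?S"
    show "(h has_derivative D' w) (at w)"
      using h(2)[OF w] at_within_open[OF w open_ball] by simp
    have "(\<lambda>n. D n w (c *s v)) \<longlonglongrightarrow> c * D' w v"
      unfolding D(2)[OF w] by (intro tendsto_intros lim w)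
    then show "D' w (c *s v) = c * D' w v" using LIMSEQ_unique lim[OF w] by blast
  qed
  then show ?thesis by (rule holomorphic_fun_cong[OF open_ball _ fh])
qed

section \<open>A criterion for normality\<close>

text \<open>If the angle were at least \<open>e\<close>, Cauchy-Schwarz for
  \<open>cinner v (v - w)\<close> would give
  \<open>norm v - norm (v - w) \<le> cos e * norm w\<close>. Together with
  \<open>norm w - norm (v - w) \<le> norm v\<close> this contradicts \<open>close\<close>; the error
  enters twice, hence the division by 2.\<close>

lemma dist_abs_cproj_less:
  assumes "v \<noteq> 0" "w \<noteq> 0" "0 < e" "e \<le> pi" and close: "norm (v - w) < norm w * (1 - cos e) / 2"
  shows "dist (abs_cproj v) (abs_cproj w) < e"
proof (rule ccontr)
  define x where "x = cmod (cinner v w) / (norm v * norm w)"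
  have x: "0 \<le> x" "x \<le> 1" using fs_cos_bounds[of v w] by (simp_all add: x_def fs_cos_def)
  assume "\<not> ?thesis"
  then have "e \<le> arccos x" using assms by (simp add: dist_abs_cproj x_def)
  then have "cos (arccos x) \<le> cos e"
    using assms x by (intro cos_monotone_0_pi_le) (auto intro: arccos_ubound)
  then have xe: "x \<le> cos e" using x by simp
  have "cinner v w = cinner v v - cinner v (v - w)" by (simp add: cinner_diff_right)
  then have "cmod (cinner v w) \<ge> cmod (cinner v v) - cmod (cinner v (v - w))"
    using norm_triangle_ineq2 by metis
  moreover have "cmod (cinner v v) = norm v * norm v"
    by (simp add: cinner_self norm_mult power2_eq_square)
  ultimately have "norm v * norm v - norm v * norm (v - w) \<le> cmod (cinner v w)"
    using cinner_Cauchy_Schwarz[of v "v - w"] by linarith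
  also have "\<dots> = norm v * (x * norm w)" using assms by (simp add: x_def)
  finally have "norm v * (norm v - norm (v - w)) \<le> norm v * (x * norm w)"
    by (simp add: right_diff_distrib)
  then have "norm v - norm (v - w) \<le> x * norm w" using assms(1) by simp
  also have "\<dots> \<le> cos e * norm w" using xe by (intro mult_right_mono) auto
  finally have "norm v - norm (v - w) \<le> cos e * norm w" .
  moreover have "norm w - norm (v - w) \<le> norm v"
    using norm_triangle_ineq2[of w v] by (simp add: norm_minus_commute)
  ultimately have "norm w * (1 - cos e) \<le> 2 * norm (v - w)" by (simp add: algebra_simps)
  then show False using close by simp
qed

text \<open>The lower bound \<open>c\<close> makes the threshold of
  \<open>dist_abs_cproj_less\<close> uniform in \<open>z\<close>; near the zero vector, directions
  would be uncontrolled.\<close>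

lemma uniform_limit_abs_cproj:
  assumes ul: "uniform_limit S \<phi> \<psi> F" and "c > 0" and lb: "\<And>z. z \<in> S \<Longrightarrow> c \<le> norm (\<psi> z)"
    and nz: "\<And>n z. z \<in> S \<Longrightarrow> \<phi> n z \<noteq> 0"
  shows "uniform_limit S (\<lambda>n z. abs_cproj (\<phi> n z)) (\<lambda>z. abs_cproj (\<psi> z)) F"
proof (rule uniform_limitI)
  fix e :: real assume e: "e > 0"
  define e' where "e' = min e 1"
  have e': "0 < e'" "e' \<le> pi" "e' \<le> e" using e pi_ge_two by (auto simp: e'_def)
  have "cos e' < 1"
    using cos_monotone_0_pi[of 0 e'] e' by simp
  then have "c * (1 - cos e') / 2 > 0" using \<open>c > 0\<close> by simp
  from uniform_limitD[OF ul this]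
  show "\<forall>\<^sub>F n in F. \<forall>z\<in>S. dist (abs_cproj (\<phi> n z)) (abs_cproj (\<psi> z)) < e"
  proof (rule eventually_mono, intro ballI)
    fix n z assume n: "\<forall>z\<in>S. dist (\<phi> n z) (\<psi> z) < c * (1 - cos e') / 2" and z: "z \<in> S"
    have "c * (1 - cos e') \<le> norm (\<psi> z) * (1 - cos e')"
      using lb[OF z] \<open>cos e' < 1\<close> by (intro mult_right_mono) auto
    then have "norm (\<phi> n z - \<psi> z) < norm (\<psi> z) * (1 - cos e') / 2"
      using n z by (fastforce simp: dist_norm)
    then have "dist (abs_cproj (\<phi> n z)) (abs_cproj (\<psi> z)) < e'"
      using nz[OF z] lb[OF z] \<open>c > 0\<close> e' by (intro dist_abs_cproj_less) auto
    then show "dist (abs_cproj (\<phi> n z)) (abs_cproj (\<psi> z)) < e" using e' by simp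
  qed
qed

text \<open>The upper bound gives equicontinuity on the half ball by Cauchy's estimate, hence a
  uniform limit on the closed quarter ball by Arzela-Ascoli. The lower bound survives in the limit
  and keeps it free of zeros. Holomorphy of the limit costs another half of the radius, which leads
  to \<open>\<rho> / 8\<close>.\<close>

lemma reduced_rep_bounded_subsequence:
  fixes s :: "nat \<Rightarrow> complex ^ 'm \<Rightarrow> 'k::finite cproj"
  assumes "\<rho> > 0" "M > 0"
    and ex: "\<And>n. \<exists>\<phi>. reduced_rep (ball z \<rho>) \<phi> (s n) \<and>
               (\<forall>w\<in>ball z \<rho>. 1 / M \<le> norm (\<phi> w) \<and> norm (\<phi> w) \<le> M)"
  obtains k g \<psi> where "strict_mono (k :: nat \<Rightarrow> nat)"
    "uniform_limit (cball z (\<rho> / 8)) (\<lambda>n. s (k n)) g sequentially"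
    "reduced_rep (ball z (\<rho> / 8)) \<psi> g"
proof -
  obtain \<phi> where rep: "\<And>n. reduced_rep (ball z \<rho>) (\<phi> n) (s n)"
    and lb: "\<And>n w. w \<in> ball z \<rho> \<Longrightarrow> 1 / M \<le> norm (\<phi> n w)"
    and ub: "\<And>n w. w \<in> ball z \<rho> \<Longrightarrow> norm (\<phi> n w) \<le> M"
    using ex by metis
  have hol: "holomorphic_fun (ball z \<rho>) (\<lambda>w. \<phi> n w $ i)" for n i
    using rep unfolding reduced_rep_def by blast
  have sub4: "cball z (\<rho> / 4) \<subseteq> ball z (\<rho> / 2)" "ball z (\<rho> / 2) \<subseteq> ball z \<rho>"
    using \<open>\<rho> > 0\<close> by (auto simp: subset_eq)
  define L where "L = real CARD('k) * (4 * M / \<rho>) + 1"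
  have L: "L > 0" unfolding L_def using assms by (intro add_nonneg_pos) auto
  have lip: "norm (\<phi> n x - \<phi> n y) \<le> L * norm (x - y)"
    if "x \<in> cball z (\<rho> / 4)" "y \<in> cball z (\<rho> / 4)" for n x y
  proof -
    have "norm (\<phi> n x - \<phi> n y) \<le> real CARD('k) * (4 * M / \<rho> * norm (x - y))"
      using sub4 that by (intro cauchy_lipschitz_vec[OF hol \<open>\<rho> > 0\<close> ub]) auto
    also have "\<dots> \<le> L * norm (x - y)" by (simp add: L_def algebra_simps)
    finally show ?thesis .
  qed
  obtain \<psi> k where k: "strict_mono (k :: nat \<Rightarrow> nat)"
    and conv: "\<And>e. e > 0 \<Longrightarrow> \<exists>N. \<forall>n x. n \<ge> N \<and> x \<in> cball z (\<rho> / 4) \<longrightarrow> norm (\<phi> (k n) x - \<psi> x) < e"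
  proof (rule Arzela_Ascoli[OF compact_cball, of z "\<rho> / 4" \<phi> M])
    show "norm (\<phi> n x) \<le> M" if "x \<in> cball z (\<rho> / 4)" for n x
      using ub sub4 that by blast
    show "\<exists>d>0. \<forall>n y. y \<in> cball z (\<rho> / 4) \<and> norm (x - y) < d \<longrightarrow> norm (\<phi> n x - \<phi> n y) < e"
      if "x \<in> cball z (\<rho> / 4)" "0 < e" for x e
    proof (intro exI[of _ "e / L"] conjI allI impI)
      show "e / L > 0" using L that by simp
      fix n y assume y: "y \<in> cball z (\<rho> / 4) \<and> norm (x - y) < e / L"
      then have "L * norm (x - y) < e" using L by (simp add: field_simps)
      then show "norm (\<phi> n x - \<phi> n y) < e" using lip[of x y n] y that by fastforce
    qed
  qed (use that in blast)
  have ul: "uniform_limit (cball z (\<rho> / 4)) (\<lambda>n. \<phi> (k n)) \<psi> sequentially"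
    unfolding uniform_limit_sequentially_iff dist_norm using conv by blast
  have lb\<psi>: "1 / M \<le> norm (\<psi> x)" if "x \<in> cball z (\<rho> / 4)" for x
  proof (rule LIMSEQ_le_const)
    show "(\<lambda>n. norm (\<phi> (k n) x)) \<longlonglongrightarrow> norm (\<psi> x)"
      by (intro tendsto_norm tendsto_uniform_limitI[OF ul that])
    have "x \<in> ball z \<rho>" using that sub4 by blast
    then show "\<exists>N. \<forall>n\<ge>N. 1 / M \<le> norm (\<phi> (k n) x)" using lb by blast
  qed
  have hol\<psi>: "holomorphic_fun (ball z (\<rho> / 8)) (\<lambda>w. \<psi> w $ i)" for i
  proof -
    have "holomorphic_fun (ball z (\<rho> / 4 / 2)) (\<lambda>w. \<psi> w $ i)"
    proof (rule holomorphic_fun_uniform_limit)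
      show "holomorphic_fun (ball z (\<rho> / 4)) (\<lambda>w. \<phi> (k n) w $ i)" for n
        using sub4 ball_subset_cball by (intro holomorphic_fun_subset[OF hol]) blast
      have "uniform_limit (cball z (\<rho> / 4)) (\<lambda>n w. \<phi> (k n) w $ i) (\<lambda>w. \<psi> w $ i) sequentially"
        by (rule bounded_linear.uniform_limit[OF bounded_linear_vec_nth ul])
      then show "uniform_limit (ball z (\<rho> / 4)) (\<lambda>n w. \<phi> (k n) w $ i) (\<lambda>w. \<psi> w $ i) sequentially"
        using ball_subset_cball uniform_limit_on_subset by blast
    qed (use \<open>\<rho> > 0\<close> in simp)
    then show ?thesis by simp
  qed
  have sub8: "cball z (\<rho> / 8) \<subseteq> cball z (\<rho> / 4)" using \<open>\<rho> > 0\<close> by auto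
  define g where "g w = abs_cproj (\<psi> w)" for w
  have nz: "\<phi> n w \<noteq> 0" "s n w = abs_cproj (\<phi> n w)" if "w \<in> ball z \<rho>" for n w
    using rep that unfolding reduced_rep_def by auto
  have nz4: "\<phi> n w \<noteq> 0" "s n w = abs_cproj (\<phi> n w)" if "w \<in> cball z (\<rho> / 4)" for n w
  proof -
    have "w \<in> ball z \<rho>" using that sub4 by blast
    then show "\<phi> n w \<noteq> 0" "s n w = abs_cproj (\<phi> n w)" by (rule nz)+
  qed
  have "uniform_limit (cball z (\<rho> / 4)) (\<lambda>n w. abs_cproj (\<phi> (k n) w)) (\<lambda>w. abs_cproj (\<psi> w)) sequentially"
    by (rule uniform_limit_abs_cproj[OF ul, of "1 / M"]) (use \<open>M > 0\<close> lb\<psi> nz4 in auto)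
  then have "uniform_limit (cball z (\<rho> / 4)) (\<lambda>n. s (k n)) g sequentially"
    by (subst uniform_limit_cong'[where g = "\<lambda>n w. abs_cproj (\<phi> (k n) w)" and i = "\<lambda>w. abs_cproj (\<psi> w)"])
       (simp_all add: nz4 g_def)
  then have "uniform_limit (cball z (\<rho> / 8)) (\<lambda>n. s (k n)) g sequentially"
    using sub8 uniform_limit_on_subset by blast
  moreover have "reduced_rep (ball z (\<rho> / 8)) \<psi> g"
    unfolding reduced_rep_def
  proof (intro conjI allI ballI)
    fix w assume "w \<in> ball z (\<rho> / 8)"
    then have "1 / M \<le> norm (\<psi> w)" using sub8 ball_subset_cball by (intro lb\<psi>) blast
    then show "\<psi> w \<noteq> 0" using \<open>M > 0\<close> by auto
  qed (simp_all add: hol\<psi> g_def)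
  ultimately show ?thesis using that k by blast
qed

text \<open>Countably many of the small balls cover \<open>D\<close>, and a diagonal subsequence
  converges on all of them.\<close>

lemma normal_family_locally_bounded:
  fixes \<F> :: "(complex ^ 'm \<Rightarrow> 'k::finite cproj) set"
  assumes "D \<noteq> {}"
    and loc: "\<And>z. z \<in> D \<Longrightarrow> \<exists>\<rho>>0. \<exists>M>0. ball z \<rho> \<subseteq> D \<and> (\<forall>f\<in>\<F>. \<exists>\<phi>. reduced_rep (ball z \<rho>) \<phi> f \<and>
               (\<forall>w\<in>ball z \<rho>. 1 / M \<le> norm (\<phi> w) \<and> norm (\<phi> w) \<le> M))"
  shows "normal_family D \<F>"
  unfolding normal_family_def
proof (intro allI impI)
  fix s :: "nat \<Rightarrow> complex ^ 'm \<Rightarrow> 'k cproj"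
  assume s: "range s \<subseteq> \<F>"
  obtain \<rho> M where \<rho>: "\<And>z. z \<in> D \<Longrightarrow> \<rho> z > 0" and M: "\<And>z. z \<in> D \<Longrightarrow> M z > 0"
    and inD: "\<And>z. z \<in> D \<Longrightarrow> ball z (\<rho> z) \<subseteq> D"
    and bd: "\<And>z f. z \<in> D \<Longrightarrow> f \<in> \<F> \<Longrightarrow> \<exists>\<phi>. reduced_rep (ball z (\<rho> z)) \<phi> f \<and>
               (\<forall>w\<in>ball z (\<rho> z). 1 / M z \<le> norm (\<phi> w) \<and> norm (\<phi> w) \<le> M z)"
    using loc by metis
  define B where "B z = ball z (\<rho> z / 8)" for z
  obtain \<B> where \<B>: "\<B> \<subseteq> B ` D" "countable \<B>" "\<Union>\<B> = \<Union>(B ` D)"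
    by (rule Lindelof[of "B ` D"]) (auto simp: B_def)
  have UB: "\<Union>(B ` D) = D"
  proof
    show "\<Union>(B ` D) \<subseteq> D"
    proof
      fix w assume "w \<in> \<Union>(B ` D)"
      then obtain z where "z \<in> D" "w \<in> ball z (\<rho> z / 8)" by (auto simp: B_def)
      then have "w \<in> ball z (\<rho> z)" using \<rho>[of z] by simp
      then show "w \<in> D" using inD[OF \<open>z \<in> D\<close>] by blast
    qed
    show "D \<subseteq> \<Union>(B ` D)" using \<rho> by (force simp: B_def)
  qed
  obtain C where C: "C \<subseteq> D" "countable C" "\<B> = B ` C"
    using countable_subset_image[of \<B> B D] \<B> by auto
  have UC: "\<Union>(B ` C) = D" using \<B>(3) UB C(3) by simp
  then have Cne: "C \<noteq> {}" using \<open>D \<noteq> {}\<close> by auto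
  \<comment> \<open>Since \<open>C\<close> is nonempty this enumerates it with values in
    \<open>C\<close> only, possibly with repetitions.\<close>
  define c where "c = from_nat_into C"
  have cD: "c i \<in> D" for i using from_nat_into[OF Cne] C(1) by (auto simp: c_def)
  have cover: "\<exists>i. w \<in> B (c i)" if "w \<in> D" for w
  proof -
    have "w \<in> \<Union>(B ` C)" unfolding UC by (rule that)
    then obtain z where "z \<in> C" "w \<in> B z" by (elim UN_E)
    moreover obtain i where "c i = z"
      using from_nat_into_surj[OF C(2) \<open>z \<in> C\<close>] by (auto simp: c_def)
    ultimately show ?thesis by blast
  qed
  define P where "P i r \<longleftrightarrow> (\<exists>g \<psi>. uniform_limit (cball (c i) (\<rho> (c i) / 8)) (\<lambda>n. s (r n)) g sequentially \<and>
      reduced_rep (B (c i)) \<psi> g)" for i and r :: "nat \<Rightarrow> nat"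
  obtain k where k: "strict_mono (k :: nat \<Rightarrow> nat)" "\<And>i. P i (id \<circ> k)"
  proof (rule subsequence_diagonalization_lemma[of P id])
    show "\<exists>k. strict_mono k \<and> P i (r \<circ> k)" for i and r :: "nat \<Rightarrow> nat"
    proof -
      have F: "s (r n) \<in> \<F>" for n using s by blast
      obtain k g \<psi> where "strict_mono (k :: nat \<Rightarrow> nat)"
        "uniform_limit (cball (c i) (\<rho> (c i) / 8)) (\<lambda>n. s (r (k n))) g sequentially"
        "reduced_rep (ball (c i) (\<rho> (c i) / 8)) \<psi> g"
        by (rule reduced_rep_bounded_subsequence[where s = "\<lambda>n. s (r n)",
              OF \<rho>[OF cD[of i]] M[OF cD[of i]] bd[OF cD[of i] F]])
      then show ?thesis unfolding P_def B_def by (intro exI[of _ k]) auto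
    qed
    show "P i (r \<circ> k2)" if Pk: "P i (r \<circ> k1)" and sub: "\<And>j. N \<le> j \<Longrightarrow> \<exists>j'. j \<le> j' \<and> k2 j = k1 j'"
      for i N and r k1 k2 :: "nat \<Rightarrow> nat"
    proof -
      obtain g \<psi> where g: "reduced_rep (B (c i)) \<psi> g"
        and ul: "uniform_limit (cball (c i) (\<rho> (c i) / 8)) (\<lambda>n. s (r (k1 n))) g sequentially"
        using Pk by (auto simp: P_def)
      have "uniform_limit (cball (c i) (\<rho> (c i) / 8)) (\<lambda>n. s (r (k2 n))) g sequentially"
        unfolding uniform_limit_sequentially_iff
      proof (intro allI impI)
        fix e :: real assume "e > 0"
        then obtain N' where N': "\<And>n x. n \<ge> N' \<Longrightarrow> x \<in> cball (c i) (\<rho> (c i) / 8) \<Longrightarrow>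
            dist (s (r (k1 n)) x) (g x) < e"
          using ul unfolding uniform_limit_sequentially_iff by metis
        show "\<exists>N. \<forall>n\<ge>N. \<forall>x\<in>cball (c i) (\<rho> (c i) / 8). dist (s (r (k2 n)) x) (g x) < e"
        proof (intro exI[of _ "max N N'"] allI impI ballI)
          fix n x assume n: "max N N' \<le> n" and x: "x \<in> cball (c i) (\<rho> (c i) / 8)"
          obtain j' where "n \<le> j'" "k2 n = k1 j'" using sub[of n] n by auto
          then show "dist (s (r (k2 n)) x) (g x) < e" using N'[of j' x] n x by simp
        qed
      qed
      then show ?thesis using g by (auto simp: P_def)
    qed
  qed (use that in blast)
  have "\<forall>i. \<exists>g \<psi>. uniform_limit (cball (c i) (\<rho> (c i) / 8)) (\<lambda>n. s (k n)) g sequentially \<and>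
      reduced_rep (B (c i)) \<psi> g"
    using k(2) unfolding P_def by simp
  then obtain G \<psi> where G: "\<And>i. uniform_limit (cball (c i) (\<rho> (c i) / 8)) (\<lambda>n. s (k n)) (G i) sequentially"
    "\<And>i. reduced_rep (B (c i)) (\<psi> i) (G i)"
    by metis
  \<comment> \<open>The limits on overlapping balls are all the pointwise limit of the same
    sequence, so they glue without a compatibility argument.\<close>
  define g where "g z = lim (\<lambda>n. s (k n) z)" for z
  have gG: "g z = G i z" if "z \<in> cball (c i) (\<rho> (c i) / 8)" for i z
    unfolding g_def by (rule limI[OF tendsto_uniform_limitI[OF G(1) that]])
  have "holomorphic_map D g"
    unfolding holomorphic_map_def
  proof
    fix z assume "z \<in> D"
    then obtain i where i: "z \<in> B (c i)" using cover by blast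
    have "reduced_rep (B (c i)) (\<psi> i) g"
      using G(2)[of i] gG[of _ i] by (auto simp: reduced_rep_def B_def)
    moreover have "B (c i) \<subseteq> D" using UB cD by blast
    ultimately show "\<exists>U h. open U \<and> z \<in> U \<and> U \<subseteq> D \<and> reduced_rep U h g"
      using i by (intro exI[of _ "B (c i)"]) (auto simp: B_def)
  qed
  moreover have "uniform_limit K (\<lambda>n. s (k n)) g sequentially" if K: "compact K" "K \<subseteq> D" for K
  proof -
    have "K \<subseteq> (\<Union>i. B (c i))" using K(2) cover by blast
    then obtain I where I: "finite I" "K \<subseteq> (\<Union>i\<in>I. B (c i))"
      using compactE_image[OF K(1), of UNIV "\<lambda>i. B (c i)"] by (auto simp: B_def)
    have "uniform_limit (B (c i)) (\<lambda>n. s (k n)) g sequentially" for i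
    proof -
      have "uniform_limit (cball (c i) (\<rho> (c i) / 8)) (\<lambda>n. s (k n)) g sequentially"
        using G(1)[of i]
        by (subst uniform_limit_cong'[where g = "\<lambda>n. s (k n)" and i = "G i"]) (simp_all add: gG[of _ i])
      then show ?thesis unfolding B_def using ball_subset_cball uniform_limit_on_subset by blast
    qed
    then have "uniform_limit (\<Union>i\<in>I. B (c i)) (\<lambda>n. s (k n)) g sequentially"
      by (intro uniform_limit_on_UNION I)
    then show ?thesis using I(2) uniform_limit_on_subset by blast
  qed
  ultimately show "\<exists>r g. strict_mono r \<and> holomorphic_map D g \<and>
      (\<forall>K. compact K \<and> K \<subseteq> D \<longrightarrow> uniform_limit K (\<lambda>k. s (r k)) g sequentially)"
    using k(1) by blast
qed

section \<open>Moving frames of hyperplanes\<close>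

text \<open>For a fixed angle, the squared distance is a quadratic polynomial in
  \<open>norm w\<close>; completing the square leaves
  \<open>(sin \<delta>)\<^sup>2 * (norm u)\<^sup>2\<close> as its minimum.\<close>

lemma norm_diff_ge_sin:
  fixes u w :: "complex ^ 'k"
  assumes "u \<noteq> 0" "w \<noteq> 0" "0 < \<delta>" "\<delta> \<le> pi" "\<delta> \<le> dist (abs_cproj u) (abs_cproj w)"
  shows "sin \<delta> * norm u \<le> norm (u - w)"
proof (rule power2_le_imp_le)
  define x where "x = cmod (cinner u w) / (norm u * norm w)"
  have x: "0 \<le> x" "x \<le> 1" using fs_cos_bounds[of u w] by (simp_all add: x_def fs_cos_def)
  have "\<delta> \<le> arccos x" using assms by (simp add: dist_abs_cproj x_def)
  then have "cos (arccos x) \<le> cos \<delta>"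
    using assms x by (intro cos_monotone_0_pi_le) (auto intro: arccos_ubound)
  then have "x \<le> cos \<delta>" using x by simp
  then have "x * (norm u * norm w) \<le> cos \<delta> * (norm u * norm w)" by (rule mult_right_mono) simp
  then have c: "cmod (cinner u w) \<le> cos \<delta> * (norm u * norm w)" using assms by (simp add: x_def)
  have "of_real ((norm (u - w))\<^sup>2) = cinner u u - cinner u w - cnj (cinner u w) + cinner w w"
    using cinner_commute[of w u] by (simp only: cinner_self[symmetric]) (simp add: cinner_simps algebra_simps)
  then have "(norm (u - w))\<^sup>2 = (norm u)\<^sup>2 - 2 * Re (cinner u w) + (norm w)\<^sup>2"
    by (simp add: cinner_self complex_eq_iff)
  moreover have "Re (cinner u w) \<le> cos \<delta> * (norm u * norm w)"
    using c complex_Re_le_cmod[of "cinner u w"] by linarith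
  moreover have "(norm u)\<^sup>2 - 2 * (cos \<delta> * (norm u * norm w)) + (norm w)\<^sup>2
      = (norm w - cos \<delta> * norm u)\<^sup>2 + (sin \<delta>)\<^sup>2 * (norm u)\<^sup>2"
    unfolding sin_squared_eq by (simp add: power2_eq_square algebra_simps)
  moreover have "(norm w - cos \<delta> * norm u)\<^sup>2 \<ge> 0" by simp
  ultimately have "(sin \<delta>)\<^sup>2 * (norm u)\<^sup>2 \<le> (norm (u - w))\<^sup>2" by linarith
  then show "(sin \<delta> * norm u)\<^sup>2 \<le> (norm (u - w))\<^sup>2" by (simp add: power_mult_distrib)
qed simp

text \<open>Factoring out \<open>c i\<close> leaves the difference of \<open>a i\<close> and a
  vector \<open>w\<close> in the span of the other vectors, and \<open>d_FS\<close> bounds the angle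
  between these two from below.\<close>

lemma d_FS_lincomb_bound:
  fixes a :: "'i \<Rightarrow> complex ^ 'k"
  assumes "finite J" and nz: "\<And>j. j \<in> J \<Longrightarrow> a j \<noteq> 0" and \<delta>: "0 < \<delta>" "\<delta> \<le> pi"
    and d: "\<delta> \<le> d_FS J (\<lambda>j. abs_cproj (a j))" and i: "i \<in> J"
  shows "sin \<delta> * cmod (c i) * norm (a i) \<le> norm (\<Sum>j\<in>J. c j *s a j)"
proof (cases "c i = 0")
  case False
  let ?A = "(\<lambda>j. abs_cproj (a j)) ` (J - {i})"
  define w where "w = (\<Sum>j\<in>J - {i}. (- c j / c i) *s a j)"
  have "(\<Sum>j\<in>J - {i}. c j *s a j) = - (c i *s w)"
    using False by (simp add: w_def vec_eq_iff sum_component sum_distrib_left sum_negf)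
  moreover have "(\<Sum>j\<in>J. c j *s a j) = c i *s a i + (\<Sum>j\<in>J - {i}. c j *s a j)"
    using assms(1) i by (simp add: sum.remove)
  ultimately have lin: "(\<Sum>j\<in>J. c j *s a j) = c i *s (a i - w)"
    by (simp add: vec_eq_iff algebra_simps)
  have eq: "norm (\<Sum>j\<in>J. c j *s a j) = cmod (c i) * norm (a i - w)"
    unfolding lin by (rule norm_cscale)
  have "sin \<delta> * norm (a i) \<le> norm (a i - w)"
  \<comment> \<open>The zero vector defines no point of \<open>proj_span\<close>; then the bound is
    just that the sine is at most 1.\<close>
  proof (cases "w = 0")
    case True
    have "sin \<delta> * norm (a i) \<le> 1 * norm (a i)" by (rule mult_right_mono) simp_all
    then show ?thesis using True by simp
  next
    case False
    have "w \<in> vec.span {v. v \<noteq> 0 \<and> abs_cproj v \<in> ?A}"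
      unfolding w_def
      by (intro vec.span_sum vec.span_scale vec.span_base) (use nz in auto)
    then have "abs_cproj w \<in> proj_span ?A" using False by (simp add: proj_span_def)
    then have "infdist (abs_cproj (a i)) (proj_span ?A) \<le> dist (abs_cproj (a i)) (abs_cproj w)"
      by (rule infdist_le)
    moreover have "d_FS J (\<lambda>j. abs_cproj (a j)) \<le> infdist (abs_cproj (a i)) (proj_span ?A)"
      unfolding d_FS_def by (rule Min_le) (use assms(1) i in auto)
    ultimately show ?thesis using d nz[OF i] False \<delta> by (intro norm_diff_ge_sin) auto
  qed
  then have "cmod (c i) * (sin \<delta> * norm (a i)) \<le> cmod (c i) * norm (a i - w)"
    by (rule mult_left_mono) simp
  then show ?thesis unfolding eq by (simp add: mult_ac)
qed simp

section \<open>Quantitative frames\<close>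

text \<open>Quantitative linear independence. The factor \<open>norm (a i)\<close> makes it
  invariant under rescaling each vector separately, as is appropriate for points of projective
  space.\<close>

definition frame :: "real \<Rightarrow> ('k::finite \<Rightarrow> complex ^ 'k) \<Rightarrow> bool" where
  "frame \<epsilon> a \<longleftrightarrow> (\<forall>i. a i \<noteq> 0) \<and>
     (\<forall>c i. \<epsilon> * cmod (c i) * norm (a i) \<le> norm (\<Sum>j\<in>UNIV. c j *s a j))"

text \<open>Reindexing by the coordinate type turns the vectors into the rows of a square matrix, so
  that determinants and Cramer's rule become available.\<close>

lemma frame_d_FS:
  fixes \<sigma> :: "'k::finite \<Rightarrow> 'i" and a :: "'i \<Rightarrow> complex ^ 'k"
  assumes \<sigma>: "bij_betw \<sigma> UNIV J" and nz: "\<And>j. j \<in> J \<Longrightarrow> a j \<noteq> 0"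
    and \<delta>: "0 < \<delta>" "\<delta> \<le> pi" and d: "\<delta> \<le> d_FS J (\<lambda>j. abs_cproj (a j))"
  shows "frame (sin \<delta>) (\<lambda>i. a (\<sigma> i))"
  unfolding frame_def
proof (intro conjI allI)
  have fin: "finite J" using bij_betw_finite[OF \<sigma>] by simp
  have \<sigma>J: "\<sigma> i \<in> J" for i using bij_betwE[OF \<sigma>] by simp
  show "a (\<sigma> i) \<noteq> 0" for i by (rule nz[OF \<sigma>J])
  fix c :: "'k \<Rightarrow> complex" and i
  define c' where "c' j = c (inv_into UNIV \<sigma> j)" for j
  have c': "c' (\<sigma> i) = c i" for i
    using \<sigma> by (simp add: c'_def bij_betw_def)
  have "(\<Sum>j\<in>J. c' j *s a j) = (\<Sum>i\<in>UNIV. c i *s a (\<sigma> i))"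
    using sum.reindex_bij_betw[OF \<sigma>, of "\<lambda>j. c' j *s a j"] by (simp add: c')
  then show "sin \<delta> * cmod (c i) * norm (a (\<sigma> i)) \<le> norm (\<Sum>j\<in>UNIV. c j *s a (\<sigma> j))"
    using d_FS_lincomb_bound[OF fin nz \<delta> d \<sigma>J[of i], of c'] by (simp add: c')
qed

lemma pairing_scale_left: "pairing (c *s v) a = c * pairing v a"
  and pairing_scale_right: "pairing v (c *s a) = c * pairing v a"
  by (simp_all add: pairing_def sum_distrib_left mult_ac)

lemma pairing_sum_right: "pairing v (\<Sum>j\<in>J. f j) = (\<Sum>j\<in>J. pairing v (f j))"
  unfolding pairing_def sum_component sum_distrib_right by (rule sum.swap)

lemma pairing_bound: "cmod (pairing v a) \<le> norm v * norm a"
proof -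
  have "cmod (pairing v a) \<le> (\<Sum>i\<in>UNIV. cmod (v $ i) * cmod (a $ i))"
    unfolding pairing_def by (rule order_trans[OF norm_sum]) (simp add: norm_mult mult.commute)
  also have "\<dots> \<le> norm v * norm a"
    unfolding norm_cvec using L2_set_mult_ineq[of "\<lambda>i. cmod (v $ i)" "\<lambda>i. cmod (a $ i)" UNIV]
    by simp
  finally show ?thesis .
qed

lemma lincomb_matrix:
  fixes a :: "'k::finite \<Rightarrow> complex ^ 'k"
  shows "(\<Sum>j\<in>UNIV. c $ j *s a j) = transpose (\<chi> i. a i) *v c"
  unfolding matrix_mult_sum by (simp add: column_transpose row_def)

lemma frame_det:
  assumes "frame \<epsilon> a" "\<epsilon> > 0"
  shows "det (\<chi> i. a i) \<noteq> 0"
proof -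
  have "c = 0" if "transpose (\<chi> i. a i) *v c = 0" for c
  proof -
    have "(\<Sum>j\<in>UNIV. c $ j *s a j) = 0" using that by (simp add: lincomb_matrix)
    moreover have "\<epsilon> * cmod (c $ i) * norm (a i) \<le> norm (\<Sum>j\<in>UNIV. c $ j *s a j)" for i
      using assms(1) unfolding frame_def by blast
    ultimately have "\<epsilon> * cmod (c $ i) * norm (a i) \<le> 0" for i by (metis norm_zero)
    moreover have "a i \<noteq> 0" for i using assms(1) by (simp add: frame_def)
    ultimately have "c $ i = 0" for i
      using \<open>\<epsilon> > 0\<close> by (metis mult_pos_pos not_less zero_less_norm_iff)
    then show ?thesis by (simp add: vec_eq_iff)
  qed
  then have "invertible (transpose (\<chi> i. a i))"
    by (simp add: invertible_left_inverse matrix_left_invertible_ker)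
  then show ?thesis by (simp add: invertible_det_nz)
qed

text \<open>Expand the conjugate of \<open>v\<close> in the frame: \<open>(norm v)\<^sup>2\<close>
  becomes a combination of the values \<open>pairing v (a j)\<close>, with coefficients bounded by
  the frame inequality. One factor \<open>norm v\<close> then cancels.\<close>

lemma frame_norm_bound:
  fixes a :: "'k::finite \<Rightarrow> complex ^ 'k"
  assumes fr: "frame \<epsilon> a" and "\<epsilon> > 0" and t: "\<And>i. cmod (pairing v (a i)) \<le> t * norm (a i)"
  shows "norm v \<le> real CARD('k) * t / \<epsilon>"
proof -
  have an: "norm (a i) > 0" for i using fr by (simp add: frame_def)
  have "t \<ge> 0"
    using t[of undefined] an[of undefined] norm_ge_zero order_trans
    by (metis mult_less_0_iff not_le)
  \<comment> \<open>\<open>pairing\<close> is bilinear, so the squared norm arises only by pairing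
    with the conjugate vector.\<close>
  define w where "w = (\<chi> i. cnj (v $ i))"
  have nw: "norm w = norm v" by (simp add: w_def norm_cvec)
  have "pairing v w = cinner v v" by (simp add: pairing_def cinner_def w_def mult.commute)
  then have vw: "cmod (pairing v w) = norm v * norm v"
    by (simp add: cinner_self norm_mult power2_eq_square)
  have "invertible (transpose (\<chi> i. a i))"
    using frame_det[OF fr \<open>\<epsilon> > 0\<close>] by (simp add: invertible_det_nz)
  then obtain B where "transpose (\<chi> i. a i) ** B = mat 1" by (auto simp: invertible_def)
  then have "transpose (\<chi> i. a i) *v (B *v w) = w" by (simp add: matrix_vector_mul_assoc)
  then obtain c where c: "(\<Sum>j\<in>UNIV. c $ j *s a j) = w" unfolding lincomb_matrix by blast
  have cb: "cmod (c $ i) * norm (a i) \<le> norm v / \<epsilon>" for i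
  proof -
    have "\<epsilon> * cmod (c $ i) * norm (a i) \<le> norm (\<Sum>j\<in>UNIV. c $ j *s a j)"
      using fr unfolding frame_def by blast
    then show ?thesis unfolding c nw using \<open>\<epsilon> > 0\<close> by (simp add: field_simps)
  qed
  have "pairing v w = (\<Sum>j\<in>UNIV. c $ j * pairing v (a j))"
    unfolding c[symmetric] by (simp add: pairing_sum_right pairing_scale_right)
  then have "norm v * norm v \<le> (\<Sum>j\<in>UNIV. cmod (c $ j * pairing v (a j)))"
    using vw norm_sum by metis
  also have "\<dots> \<le> (\<Sum>j\<in>(UNIV::'k set). t * (norm v / \<epsilon>))"
  proof (rule sum_mono)
    fix j
    have "cmod (c $ j * pairing v (a j)) \<le> cmod (c $ j) * (t * norm (a j))"
      unfolding norm_mult by (rule mult_left_mono[OF t]) simp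
    also have "\<dots> = t * (cmod (c $ j) * norm (a j))" by (simp add: mult_ac)
    also have "\<dots> \<le> t * (norm v / \<epsilon>)" by (rule mult_left_mono[OF cb \<open>t \<ge> 0\<close>])
    finally show "cmod (c $ j * pairing v (a j)) \<le> t * (norm v / \<epsilon>)" .
  qed
  finally have "norm v * norm v \<le> norm v * (real CARD('k) * t / \<epsilon>)" by (simp add: mult_ac)
  then have "norm v \<le> real CARD('k) * t / \<epsilon>" if "norm v > 0"
    using that by (simp only: mult_le_cancel_left_pos)
  moreover have "0 \<le> real CARD('k) * t / \<epsilon>" using \<open>t \<ge> 0\<close> \<open>\<epsilon> > 0\<close> by simp
  ultimately show ?thesis by (cases "norm v > 0") auto
qed

section \<open>Dual vectors and the projections built from them\<close>

text \<open>Cramer's formula for the solution of the dual basis equations. As a quotient of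
  determinants it depends holomorphically on the \<open>a i\<close>.\<close>

definition dual_vec :: "('k::finite \<Rightarrow> complex ^ 'k) \<Rightarrow> 'k \<Rightarrow> complex ^ 'k" where
  "dual_vec a k = (\<chi> l. det (\<chi> i j. if j = l then axis k 1 $ i else (\<chi> i. a i) $ i $ j) / det (\<chi> i. a i))"

lemma dual_vec_iff:
  assumes "det (\<chi> i. a i) \<noteq> 0"
  shows "b = dual_vec a k \<longleftrightarrow> (\<forall>i. pairing b (a i) = (if i = k then 1 else 0))"
proof -
  have "b = dual_vec a k \<longleftrightarrow> (\<chi> i. a i) *v b = axis k 1"
    unfolding dual_vec_def by (rule cramer[OF assms, symmetric])
  then show ?thesis
    by (simp add: vec_eq_iff matrix_vector_mult_def pairing_def axis_def)
qed

text \<open>The factor \<open>inverse (c k)\<close> cancels the rescaling of \<open>a k\<close> in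
  the products \<open>b $ l * a k $ j\<close>; the other \<open>c i\<close> do not appear.\<close>

lemma dual_vec_scale:
  assumes "det (\<chi> i. a i) \<noteq> 0" "det (\<chi> i. c i *s a i) \<noteq> 0" "c k \<noteq> 0"
  shows "dual_vec (\<lambda>i. c i *s a i) k = inverse (c k) *s dual_vec a k"
proof -
  have "pairing (dual_vec a k) (a i) = (if i = k then 1 else 0)" for i
    using dual_vec_iff[OF assms(1), of "dual_vec a k" k] by simp
  then have "inverse (c k) *s dual_vec a k = dual_vec (\<lambda>i. c i *s a i) k"
    unfolding dual_vec_iff[OF assms(2)] using assms(3)
    by (simp add: pairing_scale_left pairing_scale_right)
  then show ?thesis by simp
qed

lemma holomorphic_fun_dual_vec:
  assumes "\<And>i j. holomorphic_fun U (\<lambda>z. a i z $ j)" "\<And>z. z \<in> U \<Longrightarrow> det (\<chi> i. a i z) \<noteq> 0"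
  shows "holomorphic_fun U (\<lambda>z. dual_vec (\<lambda>i. a i z) k $ l)"
proof -
  have "holomorphic_fun U (\<lambda>z. if j = l then axis k 1 $ i else (\<chi> i. a i z) $ i $ j)" for i j
    by (cases "j = l") (simp_all add: assms(1))
  then have "holomorphic_fun U (\<lambda>z. det (\<chi> i j. if j = l then axis k 1 $ i else (\<chi> i. a i z) $ i $ j))"
    by (intro holomorphic_fun_det) simp
  moreover have "holomorphic_fun U (\<lambda>z. det (\<chi> i. a i z))"
    by (rule holomorphic_fun_det) (simp add: assms(1))
  ultimately show ?thesis
    unfolding dual_vec_def using assms(2) by (simp add: holomorphic_fun_divide)
qed

lemma rep_cproj_nonzero: "rep_cproj x \<noteq> 0"
  and abs_rep_cproj: "abs_cproj (rep_cproj x) = x"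
  using Quotient_rep_reflp[OF Quotient_cproj, of x] Quotient_abs_rep[OF Quotient_cproj, of x] by auto

lemma reduced_rep_rep_cproj:
  assumes "reduced_rep U g f" "z \<in> U"
  obtains c where "c \<noteq> 0" "g z = c *s rep_cproj (f z)"
proof -
  have "abs_cproj (rep_cproj (f z)) = abs_cproj (g z)" "g z \<noteq> 0"
    using assms by (auto simp: reduced_rep_def abs_rep_cproj)
  then show ?thesis using that abs_cproj_eq_iff rep_cproj_nonzero by metis
qed

lemma reduced_rep_subset: "reduced_rep V g f \<Longrightarrow> U \<subseteq> V \<Longrightarrow> reduced_rep U g f"
  unfolding reduced_rep_def using holomorphic_fun_subset by blast

text \<open>The index \<open>l\<close> of the column is chosen at the centre \<open>z\<close> only,
  where trace 1 forces a diagonal entry of modulus at least \<open>1 / N\<close>. Since the entries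
  are bounded by \<open>N / \<epsilon>\<close>, Cauchy's estimate keeps this entry above
  \<open>1 / (2 * N)\<close> on the ball of radius \<open>r\<close>.\<close>

lemma moving_frame_reduced_rep:
  fixes h :: "'k::finite \<Rightarrow> complex ^ 'm \<Rightarrow> 'k cproj"
  assumes hol: "\<And>i. holomorphic_map D (h i)" and D: "ball z R \<subseteq> D" "R > 0"
    and fr: "\<And>w a. w \<in> ball z R \<Longrightarrow> (\<And>i. a i \<noteq> 0) \<Longrightarrow> (\<And>i. abs_cproj (a i) = h i w) \<Longrightarrow> frame \<epsilon> a"
    and \<epsilon>: "0 < \<epsilon>" "\<epsilon> \<le> 1" and N: "N = real CARD('k)" and r: "r = R * \<epsilon> / (8 * N\<^sup>2)"
  shows "\<exists>p. reduced_rep (ball z r) p (h k) \<and>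
           (\<forall>w\<in>ball z r. 1 / (2 * N) \<le> norm (p w) \<and> norm (p w) \<le> N / \<epsilon>)"
proof -
  have N1: "N \<ge> 1" using N by (simp add: Suc_leI)
  have N2: "N\<^sup>2 \<ge> 1" using N1 by simp
  have "\<epsilon> / N\<^sup>2 \<le> 1" using \<epsilon> N2 by (simp add: divide_le_eq)
  then have "R / 8 * (\<epsilon> / N\<^sup>2) \<le> R / 8 * 1" using D(2) by (intro mult_left_mono) auto
  moreover have "r > 0" unfolding r using \<epsilon> D(2) N1 by simp
  ultimately have r': "0 < r" "r \<le> R / 8" by (simp_all add: r)
  \<comment> \<open>These representatives may depend discontinuously on \<open>w\<close>; only
    expressions independent of the scaling are formed from them.\<close>
  define a where "a w i = rep_cproj (h i w)" for w i
  have a: "a w i \<noteq> 0" "abs_cproj (a w i) = h i w" for w i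
    by (simp_all add: a_def rep_cproj_nonzero abs_rep_cproj)
  have fra: "frame \<epsilon> (a w)" if "w \<in> ball z R" for w by (rule fr[OF that a])
  have det: "det (\<chi> i. a w i) \<noteq> 0" if "w \<in> ball z R" for w by (rule frame_det[OF fra[OF that] \<epsilon>(1)])
  define b where "b w = dual_vec (a w) k" for w
  have pb: "pairing (b w) (a w i) = (if i = k then 1 else 0)" if "w \<in> ball z R" for w i
    using dual_vec_iff[OF det[OF that], of "b w" k] by (simp add: b_def)
  have nb: "norm (b w) * norm (a w k) \<le> N / \<epsilon>" if w: "w \<in> ball z R" for w
  proof -
    have pos: "norm (a w k) > 0" using a by simp
    have "norm (b w) \<le> real CARD('k) * (1 / norm (a w k)) / \<epsilon>"
      by (rule frame_norm_bound[OF fra[OF w] \<epsilon>(1)]) (use pos in \<open>simp add: pb[OF w]\<close>)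
    then have "norm (b w) * norm (a w k) \<le> real CARD('k) * (1 / norm (a w k)) / \<epsilon> * norm (a w k)"
      by (rule mult_right_mono) simp
    then show ?thesis using pos by (simp add: N)
  qed
  have "z \<in> ball z R" using D(2) by simp
  have "\<exists>l. 1 / N \<le> cmod (a z k $ l * b z $ l)"
  proof (rule ccontr)
    assume "\<not> ?thesis"
    then have lt: "cmod (a z k $ l * b z $ l) < 1 / N" for l by (simp add: not_le)
    have "1 = cmod (pairing (b z) (a z k))" using pb[OF \<open>z \<in> ball z R\<close>] by simp
    also have "\<dots> \<le> (\<Sum>l\<in>UNIV. cmod (a z k $ l * b z $ l))" unfolding pairing_def by (rule norm_sum)
    also have "\<dots> < (\<Sum>l\<in>(UNIV::'k set). 1 / N)" by (rule sum_strict_mono) (use lt in auto)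
    also have "\<dots> = 1" using N1 by (simp add: N)
    finally show False by simp
  qed
  then obtain l where l: "1 / N \<le> cmod (a z k $ l * b z $ l)" by blast
  define p where "p w = b w $ l *s a w k" for w
  have p_ub: "norm (p w) \<le> N / \<epsilon>" if "w \<in> ball z R" for w
  proof -
    have "norm (p w) \<le> norm (b w) * norm (a w k)"
      unfolding p_def norm_cscale by (intro mult_right_mono Finite_Cartesian_Product.norm_nth_le) simp
    then show ?thesis using nb[OF that] by linarith
  qed
  have p_hol: "holomorphic_fun (ball z R) (\<lambda>w. p w $ j)" for j
  proof (rule holomorphic_funI)
    fix w0 assume w0: "w0 \<in> ball z R"
    have "\<forall>i. \<exists>U g. open U \<and> w0 \<in> U \<and> U \<subseteq> D \<and> reduced_rep U g (h i)"
      using hol D(1) w0 unfolding holomorphic_map_def by blast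
    then obtain U g where U: "\<And>i. open (U i)" "\<And>i. w0 \<in> U i" and g: "\<And>i. reduced_rep (U i) (g i) (h i)"
      by metis
    define V where "V = (\<Inter>i. U i) \<inter> ball z R"
    have V: "open V" "w0 \<in> V" "V \<subseteq> ball z R" "\<And>i. V \<subseteq> U i"
      using U w0 by (auto simp: V_def intro!: open_Int open_INT)
    have gV: "reduced_rep V (g i) (h i)" for i by (rule reduced_rep_subset[OF g V(4)])
    have hg: "holomorphic_fun V (\<lambda>w. g i w $ j)" for i j using gV by (simp add: reduced_rep_def)
    \<comment> \<open>\<open>fr\<close> is assumed for arbitrary representatives, so it also applies
      to the local holomorphic ones; these compute the same \<open>p\<close>.\<close>
    have detg: "det (\<chi> i. g i w) \<noteq> 0" if "w \<in> V" for w
      by (rule frame_det[OF fr \<epsilon>(1)]) (use gV that V(3) in \<open>auto simp: reduced_rep_def\<close>)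
    have "holomorphic_fun V (\<lambda>w. dual_vec (\<lambda>i. g i w) k $ l * g k w $ j)"
      by (intro holomorphic_fun_mult holomorphic_fun_dual_vec hg detg)
    moreover have "dual_vec (\<lambda>i. g i w) k $ l * g k w $ j = p w $ j" if w: "w \<in> V" for w
    proof -
      have "\<forall>i. \<exists>c. c \<noteq> 0 \<and> g i w = c *s a w i"
        using reduced_rep_rep_cproj[OF gV w] unfolding a_def by metis
      then obtain c where c: "\<And>i. c i \<noteq> 0" "\<And>i. g i w = c i *s a w i" by metis
      have "dual_vec (\<lambda>i. g i w) k = inverse (c k) *s b w"
        unfolding b_def c(2)
        by (rule dual_vec_scale) (use det V(3) w detg[OF w] c in auto)
      then show ?thesis using c(1)[of k] by (simp add: c(2) p_def)
    qed
    ultimately have "holomorphic_fun V (\<lambda>w. p w $ j)"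
      by (rule holomorphic_fun_cong[OF V(1)])
    then show "\<exists>V. open V \<and> w0 \<in> V \<and> holomorphic_fun V (\<lambda>w. p w $ j)" using V by blast
  qed
  have p_lb: "1 / (2 * N) \<le> norm (p w)" if w: "w \<in> ball z r" for w
  proof -
    have "cmod (p w $ l - p z $ l) \<le> 4 * (N / \<epsilon>) / R * norm (w - z)"
    proof (rule cauchy_lipschitz[OF p_hol D(2)])
      show "cmod (p y $ l) \<le> N / \<epsilon>" if "y \<in> ball z R" for y
        using p_ub[OF that] Finite_Cartesian_Product.norm_nth_le[of "p y" l] by linarith
    qed (use w r' D(2) in auto)
    also have "\<dots> \<le> 4 * (N / \<epsilon>) / R * r"
      using w N1 \<epsilon> D(2) by (intro mult_left_mono) (auto simp: dist_norm norm_minus_commute)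
    \<comment> \<open>This equation determines \<open>r\<close>.\<close>
    also have "\<dots> = 1 / (2 * N)"
      using N1 \<epsilon> D(2) by (simp add: r field_simps power2_eq_square)
    finally have "cmod (p w $ l - p z $ l) \<le> 1 / (2 * N)" .
    moreover have "1 / N \<le> cmod (p z $ l)" using l by (simp add: p_def mult.commute)
    moreover have "cmod (p z $ l) \<le> cmod (p w $ l) + cmod (p w $ l - p z $ l)"
      using norm_triangle_ineq4[of "p w $ l" "p w $ l - p z $ l"] by simp
    moreover have "1 / N = 1 / (2 * N) + 1 / (2 * N)" using N1 by (simp add: field_simps)
    ultimately have "1 / (2 * N) \<le> cmod (p w $ l)" by linarith
    then show ?thesis using Finite_Cartesian_Product.norm_nth_le[of "p w" l] by linarith
  qed
  have sub: "ball z r \<subseteq> ball z R" using r' D(2) by (intro subset_ball) auto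
  show ?thesis
  proof (intro exI conjI ballI)
    show "reduced_rep (ball z r) p (h k)"
      unfolding reduced_rep_def
    proof (intro conjI allI ballI)
      show "holomorphic_fun (ball z r) (\<lambda>w. p w $ i)" for i
        by (rule holomorphic_fun_subset[OF p_hol sub])
      fix w assume w: "w \<in> ball z r"
      have "0 < 1 / (2 * N)" using N1 by simp
      then have "norm (p w) > 0" using p_lb[OF w] by linarith
      then show pw: "p w \<noteq> 0" by simp
      then have "b w $ l \<noteq> 0" by (auto simp: p_def)
      then have "abs_cproj (a w k) = abs_cproj (p w)"
        using abs_cproj_eq_iff[OF a(1) pw] unfolding p_def by blast
      then show "h k w = abs_cproj (p w)" by (simp add: a)
    qed
  qed (use p_lb p_ub sub in auto)
qed

section \<open>Maps omitting hyperplanes in general position\<close>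

lemma bij_betw_finite_type:
  assumes "finite J" "card J = CARD('k)"
  obtains \<sigma> :: "'k::finite \<Rightarrow> 'i" where "bij_betw \<sigma> UNIV J"
  using finite_same_card_bij[of "UNIV :: 'k set" J] assms by auto

text \<open>Two normalisations follow each other. Division by the pairing with \<open>p j0\<close>
  gives a holomorphic representation \<open>h\<close> on the whole ball, without bounds. Division by
  the dominating \<open>F s\<close> makes it bounded: its pairing with \<open>p s\<close> is 1,
  which bounds it below, and its other pairings are at most \<open>M\<close>, which bounds it above.
  The bounds do not involve \<open>f\<close>.\<close>

lemma omitting_map_reduced_rep:
  fixes f :: "complex ^ 'm \<Rightarrow> 'k::finite cproj" and H :: "'i \<Rightarrow> complex ^ 'm \<Rightarrow> 'k cproj"
  assumes f: "holomorphic_map D f" and B: "ball z r \<subseteq> D" "r > 0"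
    and p: "\<And>j. j \<in> I \<Longrightarrow> reduced_rep (ball z r) (p j) (H j)"
    and plb: "\<And>j w. j \<in> I \<Longrightarrow> w \<in> ball z r \<Longrightarrow> c \<le> norm (p j w)"
    and pub: "\<And>j w. j \<in> I \<Longrightarrow> w \<in> ball z r \<Longrightarrow> norm (p j w) \<le> C"
    and c: "0 < c" "c \<le> C" and \<epsilon>: "\<epsilon> > 0"
    and fr: "\<And>J \<sigma> w. J \<subseteq> I \<Longrightarrow> bij_betw \<sigma> (UNIV :: 'k set) J \<Longrightarrow> w \<in> ball z r \<Longrightarrow> frame \<epsilon> (\<lambda>i. p (\<sigma> i) w)"
    and I: "finite I" "card I + 1 = 2 * CARD('k)"
    and omit: "\<And>j. j \<in> I \<Longrightarrow> inverse_image D f (H j) = {}"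
    and N: "N = real CARD('k)" and C1: "C1 = 2 * N * C / (\<epsilon> * c)"
    and M: "dominance_constant I C1 M"
  shows "\<exists>\<phi>. reduced_rep (ball z (r / 16)) \<phi> f \<and>
           (\<forall>w\<in>ball z (r / 16). 1 / C \<le> norm (\<phi> w) \<and> norm (\<phi> w) \<le> N * M / (\<epsilon> * c))"
proof -
  have k1: "CARD('k) \<ge> 1" by (simp add: Suc_leI)
  have N1: "N \<ge> 1" using k1 N by simp
  have Cpos: "C > 0" using c by linarith
  have C1pos: "C1 > 0" unfolding C1 using N1 Cpos \<epsilon> c by simp
  have "I \<noteq> {}" using I(2) k1 by auto
  then obtain j0 where j0: "j0 \<in> I" by blast
  have nonzero: "pairing (g w) (p j w) \<noteq> 0"
    if "j \<in> I" "w \<in> U" "open U" "U \<subseteq> ball z r" "reduced_rep U g f" for j w U g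
  proof
    assume "pairing (g w) (p j w) = 0"
    moreover have "reduced_rep U (p j) (H j)" by (rule reduced_rep_subset[OF p[OF that(1)] that(4)])
    ultimately have "w \<in> inverse_image D f (H j)"
      unfolding inverse_image_def using that B(1) by blast
    then show False using omit[OF that(1)] by blast
  qed
  define a where "a w = rep_cproj (f w)" for w
  txt \<open>The normalisation makes the representation independent of the choice of \<open>rep_cproj\<close>.\<close>
  define h where "h w = inverse (pairing (a w) (p j0 w)) *s a w" for w
  have local_rep: "\<exists>U g. open U \<and> w \<in> U \<and> U \<subseteq> ball z r \<and> reduced_rep U g f \<and>
      (\<forall>y\<in>U. h y = inverse (pairing (g y) (p j0 y)) *s g y)" if w: "w \<in> ball z r" for w
  proof -
    obtain V g where V: "open V" "w \<in> V" "V \<subseteq> D" "reduced_rep V g f"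
      using f w B(1) unfolding holomorphic_map_def by blast
    define U where "U = V \<inter> ball z r"
    have U: "open U" "w \<in> U" "U \<subseteq> ball z r" "reduced_rep U g f"
      using V w by (auto simp: U_def intro: reduced_rep_subset)
    have "h y = inverse (pairing (g y) (p j0 y)) *s g y" if y: "y \<in> U" for y
    proof -
      obtain d where d: "d \<noteq> 0" "g y = d *s rep_cproj (f y)"
        by (rule reduced_rep_rep_cproj[OF U(4) y])
      then show ?thesis by (simp add: h_def a_def pairing_scale_left)
    qed
    then show ?thesis using U by blast
  qed
  have h_hol: "holomorphic_fun (ball z r) (\<lambda>w. h w $ i)" for i
  proof (rule holomorphic_funI)
    fix w assume "w \<in> ball z r"
    then obtain U g where U: "open U" "w \<in> U" "U \<subseteq> ball z r" and g: "reduced_rep U g f"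
      and hg: "\<And>y. y \<in> U \<Longrightarrow> h y = inverse (pairing (g y) (p j0 y)) *s g y"
      using local_rep by metis
    have p0: "reduced_rep U (p j0) (H j0)" by (rule reduced_rep_subset[OF p[OF j0] U(3)])
    have "holomorphic_fun U (\<lambda>y. inverse (pairing (g y) (p j0 y)) * g y $ i)"
      using g p0 nonzero[OF j0 _ U(1,3) g] unfolding reduced_rep_def
      by (intro holomorphic_fun_mult holomorphic_fun_inverse holomorphic_fun_pairing) auto
    then have "holomorphic_fun U (\<lambda>y. h y $ i)"
      by (rule holomorphic_fun_cong[OF U(1)]) (simp add: hg)
    then show "\<exists>V. open V \<and> w \<in> V \<and> holomorphic_fun V (\<lambda>w. h w $ i)" using U by blast
  qed
  have h_rep: "h w \<noteq> 0" "f w = abs_cproj (h w)" if w: "w \<in> ball z r" for w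
  proof -
    obtain U g where U: "open U" "w \<in> U" "U \<subseteq> ball z r" and g: "reduced_rep U g f"
      and hg: "h w = inverse (pairing (g w) (p j0 w)) *s g w"
      using local_rep[OF w] by metis
    have nz: "inverse (pairing (g w) (p j0 w)) \<noteq> 0" using nonzero[OF j0 U(2,1,3) g] by simp
    have gw: "g w \<noteq> 0" "f w = abs_cproj (g w)" using g U(2) by (auto simp: reduced_rep_def)
    show hw: "h w \<noteq> 0" using nz gw by (simp add: hg)
    show "f w = abs_cproj (h w)"
      using abs_cproj_eq_iff[OF gw(1) hw] nz hg gw(2) by metis
  qed
  define F where "F j w = pairing (h w) (p j w)" for j w
  have F_hol: "holomorphic_fun (ball z r) (F j)" if "j \<in> I" for j
    unfolding F_def using p[OF that] by (intro holomorphic_fun_pairing h_hol) (auto simp: reduced_rep_def)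
  have F_nz: "F j w \<noteq> 0" if j: "j \<in> I" and w: "w \<in> ball z r" for j w
  proof -
    obtain U g where U: "open U" "w \<in> U" "U \<subseteq> ball z r" and g: "reduced_rep U g f"
      and hg: "h w = inverse (pairing (g w) (p j0 w)) *s g w"
      using local_rep[OF w] by metis
    show ?thesis
      using nonzero[OF j0 U(2,1,3) g] nonzero[OF j U(2,1,3) g] by (simp add: F_def hg pairing_scale_left)
  qed
  \<comment> \<open>n+1 pairings with hyperplanes in general position control a vector; the division
    by \<open>c\<close> turns the absolute bound \<open>t\<close> into one relative to
    \<open>norm (p j w)\<close>.\<close>
  have control: "norm v \<le> N * t / (\<epsilon> * c)"
    if J: "J \<subseteq> I" "card J = CARD('k)" and w: "w \<in> ball z r"
      and t: "\<And>j. j \<in> J \<Longrightarrow> cmod (pairing v (p j w)) \<le> t" for J w v t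
  proof -
    have "finite J" using J(1) I(1) finite_subset by blast
    then obtain \<sigma> :: "'k \<Rightarrow> 'i" where \<sigma>: "bij_betw \<sigma> UNIV J" using J(2) by (rule bij_betw_finite_type)
    have \<sigma>J: "\<sigma> i \<in> J" for i using bij_betwE[OF \<sigma>] by simp
    have "norm v \<le> real CARD('k) * (t / c) / \<epsilon>"
    proof (rule frame_norm_bound[OF fr[OF J(1) \<sigma> w] \<epsilon>])
      fix i
      have t0: "0 \<le> t" using t[OF \<sigma>J[of i]] norm_ge_zero order_trans by blast
      have "t = t / c * c" using c by simp
      also have "\<dots> \<le> t / c * norm (p (\<sigma> i) w)"
        using plb[OF _ w, of "\<sigma> i"] \<sigma>J[of i] J(1) t0 c by (intro mult_left_mono) auto
      finally show "cmod (pairing v (p (\<sigma> i) w)) \<le> t / c * norm (p (\<sigma> i) w)"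
        using t[OF \<sigma>J[of i]] by linarith
    qed
    then show ?thesis by (simp add: N mult.commute)
  qed
  have maj: "card I < 2 * card {i \<in> I. \<forall>j\<in>I. cmod (F j w) \<le> C1 * cmod (F i w)}"
    if w: "w \<in> ball z r" for w
  proof -
    define T where "T = {i \<in> I. \<forall>j\<in>I. cmod (F j w) \<le> C1 * cmod (F i w)}"
    \<comment> \<open>\<open>C1\<close> is chosen so that n+1 exceptional indices would give
      \<open>norm (h w) \<le> norm (h w) / 2\<close>.\<close>
    have "card (I - T) < CARD('k)"
    proof (rule ccontr)
      assume "\<not> card (I - T) < CARD('k)"
      then obtain J where J: "J \<subseteq> I - T" "card J = CARD('k)"
        using obtain_subset_with_card_n[of "CARD('k)" "I - T"] by (auto simp: not_less)
      have small: "cmod (pairing (h w) (p i w)) \<le> norm (h w) * C / C1" if "i \<in> J" for i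
      proof -
        have "i \<in> I" "i \<notin> T" using that J(1) by blast+
        then obtain j where j: "j \<in> I" "C1 * cmod (F i w) < cmod (F j w)"
          by (auto simp: T_def not_le)
        have "cmod (F j w) \<le> norm (h w) * norm (p j w)" unfolding F_def by (rule pairing_bound)
        also have "\<dots> \<le> norm (h w) * C" by (intro mult_left_mono pub j w) simp
        finally have "C1 * cmod (F i w) \<le> norm (h w) * C" using j by linarith
        then show ?thesis using C1pos by (simp add: F_def field_simps)
      qed
      have "norm (h w) \<le> N * (norm (h w) * C / C1) / (\<epsilon> * c)"
        by (rule control[OF _ J(2) w small]) (use J(1) in auto)
      also have "\<dots> = norm (h w) / 2" unfolding C1 using N1 Cpos \<epsilon> c by (simp add: field_simps)
      finally show False using h_rep(1)[OF w] by simp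
    qed
    moreover have "card I = card T + card (I - T)"
      using card_Int_Diff[of I T] I(1) by (simp add: T_def Int_def conj_ac) 
    ultimately show ?thesis using I(2) unfolding T_def by linarith
  qed
  have z: "z \<in> ball z r" using B(2) by simp
  obtain s where s: "s \<in> I" "\<And>j. j \<in> I \<Longrightarrow> cmod (F j z) \<le> C1 * cmod (F s z)"
  proof -
    have "{i \<in> I. \<forall>j\<in>I. cmod (F j z) \<le> C1 * cmod (F i z)} \<noteq> {}" using maj[OF z] by force
    then show ?thesis using that by blast
  qed
  have dom: "cmod (F j w) \<le> M * cmod (F s w)" if j: "j \<in> I" and w: "w \<in> ball z (r / 16)" for j w
  proof -
    \<comment> \<open>On the line with parameter \<open>\<zeta>\<close>, the unit disc stays in
      \<open>ball z r\<close> and \<open>w\<close> sits at 1/16, the radius allowed by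
      \<open>dominance_constant\<close>.\<close>
    define v where "v = 16 *s (w - z)"
    have "norm v = 16 * norm (w - z)" unfolding v_def norm_cscale by simp
    then have nv: "norm v < r" using w by (simp add: dist_norm norm_minus_commute)
    have inb: "z + \<zeta> *s v \<in> ball z r" if "\<zeta> \<in> ball 0 1" for \<zeta>
    proof -
      have "cmod \<zeta> * norm v \<le> 1 * norm v" using that by (intro mult_right_mono) auto
      then show ?thesis using nv by (simp add: dist_norm norm_cscale)
    qed
    have "cmod (F j (z + (1 / 16) *s v)) \<le> M * cmod (F s (z + (1 / 16) *s v))"
    proof (rule dominance_constantD[OF M, of "\<lambda>j \<zeta>. F j (z + \<zeta> *s v)" s "1 / 16" j])
      show "(\<lambda>\<zeta>. F j (z + \<zeta> *s v)) holomorphic_on ball 0 1" if "j \<in> I" for j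
        by (rule holomorphic_on_line[OF F_hol[OF that] open_ball inb])
      show "F j (z + \<zeta> *s v) \<noteq> 0" if "j \<in> I" "\<zeta> \<in> ball 0 1" for j \<zeta>
        by (rule F_nz[OF that(1) inb[OF that(2)]])
      show "card I < 2 * card {i \<in> I. \<forall>j\<in>I. cmod (F j (z + \<zeta> *s v)) \<le> C1 * cmod (F i (z + \<zeta> *s v))}"
        if "\<zeta> \<in> ball 0 1" for \<zeta>
        by (rule maj[OF inb[OF that]])
    qed (use s j in auto)
    moreover have "z + (1 / 16) *s v = w" by (simp add: v_def vec_eq_iff)
    ultimately show ?thesis by simp
  qed
  have sub: "ball z (r / 16) \<subseteq> ball z r" using B(2) by (intro subset_ball) auto
  define \<phi> where "\<phi> w = inverse (F s w) *s h w" for w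
  have pairing_\<phi>: "pairing (\<phi> w) (p j w) = F j w / F s w" for j w
    by (simp add: \<phi>_def pairing_scale_left F_def divide_inverse mult.commute)
  show ?thesis
  proof (intro exI conjI ballI)
    show "reduced_rep (ball z (r / 16)) \<phi> f"
      unfolding reduced_rep_def
    proof (intro conjI allI ballI)
      fix i
      have "holomorphic_fun (ball z r) (\<lambda>w. inverse (F s w) * h w $ i)"
        by (intro holomorphic_fun_mult holomorphic_fun_inverse F_hol F_nz h_hol s)
      then show "holomorphic_fun (ball z (r / 16)) (\<lambda>w. \<phi> w $ i)"
        using holomorphic_fun_subset[OF _ sub] by (simp add: \<phi>_def)
    next
      fix w assume "w \<in> ball z (r / 16)"
      then have w: "w \<in> ball z r" using sub by blast
      have nz: "inverse (F s w) \<noteq> 0" using F_nz[OF s(1) w] by simp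
      then show \<phi>nz: "\<phi> w \<noteq> 0" using h_rep(1)[OF w] by (simp add: \<phi>_def)
      show "f w = abs_cproj (\<phi> w)"
        using abs_cproj_eq_iff[OF h_rep(1)[OF w] \<phi>nz] nz h_rep(2)[OF w] by (metis \<phi>_def)
    qed
    fix w assume w16: "w \<in> ball z (r / 16)"
    then have w: "w \<in> ball z r" using sub by blast
    have "1 = cmod (pairing (\<phi> w) (p s w))" using F_nz[OF s(1) w] by (simp add: pairing_\<phi>)
    also have "\<dots> \<le> norm (\<phi> w) * norm (p s w)" by (rule pairing_bound)
    also have "\<dots> \<le> norm (\<phi> w) * C" by (intro mult_left_mono pub s w) simp
    finally show "1 / C \<le> norm (\<phi> w)" using Cpos by (simp add: field_simps)
    have "CARD('k) \<le> card I" using I(2) k1 by linarith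
    then obtain J where J: "J \<subseteq> I" "card J = CARD('k)"
      using obtain_subset_with_card_n[of "CARD('k)" I] by auto
    show "norm (\<phi> w) \<le> N * M / (\<epsilon> * c)"
    proof (rule control[OF J w])
      fix j assume "j \<in> J"
      then have "cmod (F j w) \<le> M * cmod (F s w)" using J(1) by (intro dom w16) auto
      then show "cmod (pairing (\<phi> w) (p j w)) \<le> M"
        using F_nz[OF s(1) w] by (simp add: pairing_\<phi> norm_divide divide_le_eq)
    qed
  qed
qed

theorem theorem3p1:
  fixes n :: nat
    and D :: "(complex ^ 'm) set"
    and \<F> :: "(complex ^ 'm \<Rightarrow> 'k::finite cproj) set"
    and H :: "(complex ^ 'm \<Rightarrow> 'k cproj) \<Rightarrow> nat \<Rightarrow> complex ^ 'm \<Rightarrow> 'k cproj"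
  assumes "n \<ge> 1" and "CARD('k) = n + 1"
    and "open D" and "connected D" and "D \<noteq> {}"
    and "\<And>f. f \<in> \<F> \<Longrightarrow> holomorphic_map D f"
    and "\<And>f j. f \<in> \<F> \<Longrightarrow> j \<in> {1..2 * n + 1} \<Longrightarrow> holomorphic_map D (H f j)"
    and "\<And>K. compact K \<Longrightarrow> K \<subseteq> D \<Longrightarrow>
           \<exists>\<delta>>0. \<forall>J z f. J \<subseteq> {1..2 * n + 1} \<and> card J = n + 1 \<and> z \<in> K \<and> f \<in> \<F> \<longrightarrow>
             d_FS J (\<lambda>j. H f j z) \<ge> \<delta>"
    and "\<And>f j. f \<in> \<F> \<Longrightarrow> j \<in> {1..2 * n + 1} \<Longrightarrow> inverse_image D f (H f j) = {}"
  shows "normal_family D \<F>"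
proof (rule normal_family_locally_bounded[OF \<open>D \<noteq> {}\<close>])
  fix z assume "z \<in> D"
  define I where "I = {1..2 * n + 1}"
  have I: "finite I" "card I + 1 = 2 * CARD('k)" using assms(2) by (simp_all add: I_def)
  obtain R where R: "R > 0" "cball z R \<subseteq> D"
    using assms(3) \<open>z \<in> D\<close> open_contains_cball by blast
  have ballD: "ball z R \<subseteq> D" using R(2) ball_subset_cball by blast
  obtain \<delta>' where \<delta>': "\<delta>' > 0" "\<And>J w f. J \<subseteq> I \<Longrightarrow> card J = n + 1 \<Longrightarrow> w \<in> cball z R \<Longrightarrow> f \<in> \<F> \<Longrightarrow>
      d_FS J (\<lambda>j. H f j w) \<ge> \<delta>'"
    using assms(8)[OF compact_cball R(2)] unfolding I_def by blast
  \<comment> \<open>The cut-off at 1 keeps \<open>\<delta>\<close> strictly below \<open>pi\<close>,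
    where its sine is positive.\<close>
  define \<delta> where "\<delta> = min \<delta>' 1"
  have \<delta>: "0 < \<delta>" "\<delta> \<le> 1" "\<delta> \<le> \<delta>'" using \<delta>'(1) by (auto simp: \<delta>_def)
  have \<delta>pi: "\<delta> \<le> pi" "\<delta> < pi" using \<delta>(2) pi_ge_two by linarith+
  define \<epsilon> where "\<epsilon> = sin \<delta>"
  have \<epsilon>: "0 < \<epsilon>" "\<epsilon> \<le> 1" using sin_gt_zero[OF \<delta>(1) \<delta>pi(2)] by (simp_all add: \<epsilon>_def)
  have fr: "frame \<epsilon> (\<lambda>i. a (\<sigma> i))"
    if "f \<in> \<F>" "J \<subseteq> I" "bij_betw \<sigma> (UNIV :: 'k set) J" "w \<in> ball z R"
      "\<And>j. j \<in> J \<Longrightarrow> a j \<noteq> 0" "\<And>j. j \<in> J \<Longrightarrow> abs_cproj (a j) = H f j w" for f J w a \<sigma>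
  proof -
    have "card J = n + 1" using bij_betw_same_card[OF that(3)] assms(2) by simp
    then have "\<delta>' \<le> d_FS J (\<lambda>j. H f j w)" using that by (intro \<delta>'(2)) auto
    moreover have "d_FS J (\<lambda>j. H f j w) = d_FS J (\<lambda>j. abs_cproj (a j))"
    proof -
      have "(\<lambda>j. H f j w) ` (J - {i}) = (\<lambda>j. abs_cproj (a j)) ` (J - {i})" for i
        using that(6) by (intro image_cong) auto
      then show ?thesis
        unfolding d_FS_def using that(6) by (intro arg_cong[where f = Min] image_cong) auto
    qed
    ultimately show ?thesis
      unfolding \<epsilon>_def using \<delta> by (intro frame_d_FS[OF that(3,5) \<delta>(1) \<delta>pi(1)]) auto
  qed
  define N where "N = real CARD('k)"
  have N1: "N \<ge> 1" by (simp add: N_def Suc_leI)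
  define r where "r = R * \<epsilon> / (8 * N\<^sup>2)"
  have "r > 0" using R(1) \<epsilon> N1 by (simp add: r_def)
  have "1 \<le> N\<^sup>2" by (rule one_le_power[OF N1])
  then have "\<epsilon> / (8 * N\<^sup>2) \<le> 1" using \<epsilon> by (simp add: divide_le_eq)
  then have "R * (\<epsilon> / (8 * N\<^sup>2)) \<le> R * 1" using R(1) by (intro mult_left_mono) auto
  then have rR: "r \<le> R" by (simp add: r_def)
  have sub: "ball z r \<subseteq> ball z R" by (rule subset_ball[OF rR])
  have rD: "ball z r \<subseteq> D" using sub ballD by blast
  define C where "C = N / \<epsilon>"
  define c where "c = 1 / (2 * N)"
  have cC: "0 < c" "c \<le> C"
  proof -
    show "0 < c" using N1 by (simp add: c_def)
    have "c \<le> 1" using N1 by (simp add: c_def divide_le_eq)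
    moreover have "1 \<le> C" using N1 \<epsilon> by (simp add: C_def le_divide_eq)
    ultimately show "c \<le> C" by linarith
  qed
  define C1 where "C1 = 2 * N * C / (\<epsilon> * c)"
  have "C1 > 0" using N1 \<epsilon> cC by (simp add: C1_def)
  \<comment> \<open>\<open>M\<close> is fixed before \<open>f\<close>: it depends only on
    \<open>I\<close> and \<open>C1\<close>, and \<open>C1\<close> only on the dimension and
    \<open>\<epsilon>\<close>.\<close>
  obtain M where M: "M > 0" "dominance_constant I C1 M"
    using dominance_constant_exists[OF I(1) \<open>C1 > 0\<close>] by blast
  define M' where "M' = max C (N * M / (\<epsilon> * c))"
  have "C > 0" using cC by linarith
  show "\<exists>\<rho>>0. \<exists>M>0. ball z \<rho> \<subseteq> D \<and> (\<forall>f\<in>\<F>. \<exists>\<phi>. reduced_rep (ball z \<rho>) \<phi> f \<and>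
          (\<forall>w\<in>ball z \<rho>. 1 / M \<le> norm (\<phi> w) \<and> norm (\<phi> w) \<le> M))"
  proof (rule exI[of _ "r / 16"], rule conjI, simp add: \<open>r > 0\<close>, rule exI[of _ M'], intro conjI ballI)
    show "M' > 0" using \<open>C > 0\<close> by (simp add: M'_def)
    have "ball z (r / 16) \<subseteq> ball z r" using \<open>r > 0\<close> by (intro subset_ball) auto
    then show "ball z (r / 16) \<subseteq> D" using rD by blast
    fix f assume f: "f \<in> \<F>"
    have "\<exists>p. reduced_rep (ball z r) p (H f j) \<and> (\<forall>w\<in>ball z r. c \<le> norm (p w) \<and> norm (p w) \<le> C)"
      if j: "j \<in> I" for j
    proof -
      \<comment> \<open>A single hyperplane is completed to a frame by any n of the other
        2n.\<close>
      have "n \<le> card (I - {j})" using j I(1) by (simp add: I_def)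
      then obtain J' where J': "J' \<subseteq> I - {j}" "card J' = n" "finite J'"
        using obtain_subset_with_card_n by metis
      have J: "finite (insert j J')" "card (insert j J') = CARD('k)" "insert j J' \<subseteq> I"
        using J' j assms(2) by (auto simp: card_insert_if)
      obtain \<sigma> :: "'k \<Rightarrow> nat" where \<sigma>: "bij_betw \<sigma> UNIV (insert j J')"
        by (rule bij_betw_finite_type[OF J(1,2)])
      have \<sigma>I: "\<sigma> i \<in> I" for i using bij_betwE[OF \<sigma>] J(3) by auto
      obtain k where k: "\<sigma> k = j" using \<sigma> by (metis bij_betw_imp_surj_on imageE insertI1)
      have "\<exists>p. reduced_rep (ball z r) p (H f (\<sigma> k)) \<and>
          (\<forall>w\<in>ball z r. 1 / (2 * N) \<le> norm (p w) \<and> norm (p w) \<le> N / \<epsilon>)"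
      proof (rule moving_frame_reduced_rep[OF _ ballD R(1) _ \<epsilon> N_def r_def])
        show "holomorphic_map D (H f (\<sigma> i))" for i
          using assms(7)[OF f] \<sigma>I[of i] by (simp add: I_def)
        show "frame \<epsilon> a" if w: "w \<in> ball z R" and a: "\<And>i. a i \<noteq> 0" "\<And>i. abs_cproj (a i) = H f (\<sigma> i) w" for w a
        proof -
          \<comment> \<open>\<open>fr\<close> expects representatives indexed by the hyperplane
            numbers, so \<open>a\<close> is transported along the inverse of
            \<open>\<sigma>\<close>.\<close>
          define a' where "a' j = a (inv_into UNIV \<sigma> j)" for j
          have a': "a' (\<sigma> i) = a i" for i using \<sigma> by (simp add: a'_def bij_betw_def)
          have "frame \<epsilon> (\<lambda>i. a' (\<sigma> i))"
          proof (rule fr[OF f J(3) \<sigma> w])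
            fix x assume x: "x \<in> insert j J'"
            show "a' x \<noteq> 0" by (simp add: a'_def a)
          next
            fix x assume x: "x \<in> insert j J'"
            show "abs_cproj (a' x) = H f x w"
              using x a(2) \<sigma> unfolding a'_def by (metis bij_betw_imp_surj_on f_inv_into_f)
          qed
          then show ?thesis by (simp add: a')
        qed
      qed
      then show ?thesis by (simp add: k c_def C_def)
    qed
    then obtain p where p: "\<And>j. j \<in> I \<Longrightarrow> reduced_rep (ball z r) (p j) (H f j)"
      "\<And>j w. j \<in> I \<Longrightarrow> w \<in> ball z r \<Longrightarrow> c \<le> norm (p j w)"
      "\<And>j w. j \<in> I \<Longrightarrow> w \<in> ball z r \<Longrightarrow> norm (p j w) \<le> C"
      by metis
    have "\<exists>\<phi>. reduced_rep (ball z (r / 16)) \<phi> f \<and>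
        (\<forall>w\<in>ball z (r / 16). 1 / C \<le> norm (\<phi> w) \<and> norm (\<phi> w) \<le> N * M / (\<epsilon> * c))"
    proof (rule omitting_map_reduced_rep[OF assms(6)[OF f] rD \<open>r > 0\<close> p cC \<epsilon>(1) _ I _ N_def C1_def M(2)])
      show "frame \<epsilon> (\<lambda>i. p (\<sigma> i) w)"
        if "J \<subseteq> I" "bij_betw \<sigma> (UNIV :: 'k set) J" "w \<in> ball z r" for J \<sigma> w
        using p(1) that sub by (intro fr[OF f that(1,2), of w "\<lambda>j. p j w"]) (auto simp: reduced_rep_def)
      show "inverse_image D f (H f j) = {}" if "j \<in> I" for j
        using assms(9)[OF f] that by (simp add: I_def)
    qed
    then obtain \<phi> where \<phi>: "reduced_rep (ball z (r / 16)) \<phi> f"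
      "\<And>w. w \<in> ball z (r / 16) \<Longrightarrow> 1 / C \<le> norm (\<phi> w) \<and> norm (\<phi> w) \<le> N * M / (\<epsilon> * c)"
      by blast
    have "1 / M' \<le> 1 / C" using \<open>C > 0\<close> by (intro divide_left_mono) (auto simp: M'_def)
    then show "\<exists>\<phi>. reduced_rep (ball z (r / 16)) \<phi> f \<and>
        (\<forall>w\<in>ball z (r / 16). 1 / M' \<le> norm (\<phi> w) \<and> norm (\<phi> w) \<le> M')"
      using \<phi> by (intro exI[of _ \<phi>]) (force simp: M'_def)
  qed
qed

end
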